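(* Let $(X,\mu,T)$, together with the open sets $\{X_i\}_{i\in\mathcal I}$, be a system as described in the context, satisfying the Ahlfors regularity (of dimension $\delta>0$), uniform mixing, bounded distortion, expanding, and conformality conditions listed there. Let $\psi:\mathbb{N}\to\mathbb{R}_+$ (positive values) satisfy $\lim_{n\to\infty}\psi(n)=0$, and let $f:X\to X$ be piecewise Lipschitz. Assume furthermore that $\{X_i\}_{i\in\mathcal I}$ is pseudo-Markov with respect to $T$. If the series $\sum_{n=1}^\infty\psi(n)^\delta$ diverges, then $\mu\big(R_T^f(\psi)\big)=1$, where $$R_T^f(\psi):=\{x\in X: d(T^nx,f(x))<\psi(n)\text{ for infinitely many }n\in\mathbb{N}\}.$$
   Context: $(X,d)$ is a separable compact metric space, $B(x,r)$ denotes the open ball of radius $r$ centered at $x$, and $(X,\mu,T)$ is a probability measure preserving system ($\mu$ a Borel probability measure, $T:X\to X$ measurable and $\mu$-preserving). Cylinders: there are at most countably many pairwise disjoint open subsets $X_i$, $i\in\mathcal I$, of $X$ such that $T|_{X_i}$ is continuous and injective for each $i$ and $\mu(X\setminus\bigcup_iX_i)=0$. For $m\in\mathbb{N}$, $\mathcal F_m:=\{X_{i_1}\cap T^{-1}X_{i_2}\cap\cdots\cap T^{-(m-1)}X_{i_m}: i_1,\dots,i_m\in\mathcal I\}$ (cylinders of order $m$). For $J\in\mathcal F_m$, $K_J:=\inf_{x,y\in J,\,x\ne y}\frac{d(T^mx,T^my)}{d(x,y)}$ (with $\inf\varnothing=+\infty$). Conditions assumed: - Ahlfors regularity of dimension $\delta>0$: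 there are $\eta_1,\eta_2,r_0>0$ with $\eta_1r^\delta\le\mu(B(x,r))\le\eta_2r^\delta$ for every ball $B(x,r)\subset X$ with $0<r<r_0$. - Uniform mixing: there is a summable sequence of positive reals $(a_n)_{n\in\mathbb N}$ with $|\mu(E\cap T^{-n}F)-\mu(E)\mu(F)|\le a_n\mu(F)$ for all balls $E,F\subset X$ and all $n\ge1$. - Bounded distortion: there is $K_1>0$ with $K_1^{-1}\le\frac{d(T^mx,T^my)/d(x,y)}{d(T^mx,T^mz)/d(x,z)}\le K_1$ for all $m\in\mathbb N$ and all $x,y,z\in J\in\mathcal F_m$ with $x\ne y$, $x\ne z$. - Expanding: $\inf_{J\in\mathcal F_m}K_J\to\infty$ as $m\to\infty$, and $\sup_{m\in\mathbb N}\sum_{J\in\mathcal F_m}K_J^{-\delta}<\infty$. - Conformality: there is $K_2\ge1$ with $B(T^mx,K_2^{-1}K_Jr)\subset T^mB(x,r)\subset B(T^mx,K_2K_Jr)$ for any $m\in\mathbb N$ and any ball $B(x,r)\subset J\in\mathcal F_m$. Pseudo-Markov: $\{X_i\}_{i\in\mathcal I}$ is pseudo-Markov with respect to $T$ if (1) $TX_i$ is measurable for all $i\in\mathcal I$; (2) for any $i,j\in\mathcal I$, $TX_i\cap X_j\ne\varnothing$ implies $X_j\subset TX_i$; (3) there exists $\tau>0$ such that $\mu(TX_i)\ge\tau\mu(X)$ for any $i\in\mathcal I$. A map $g:X\to X$ is Lipschitz if $\sup_{x\neq y}d(g(x),g(y))/d(x,y)<\infty$. A map $f:X\to X$ is piecewise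 Lipschitz if there are at most countably many measurable subsets $Y_i$ of $X$ and Lipschitz functions $f_i:X\to X$ with $\mu(X\setminus\bigcup_iY_i)=0$ and $f|_{Y_i}=f_i|_{Y_i}$ for each $i$. *)

theory Defs
  imports "HOL-Probability.Probability"
begin

text \<open>
  The space is the universe of a type of class
  \<open>{metric_space, second_countable_topology}\<close> (for metric spaces, second countable means
  separable), with compactness assumed separately. Natural-number indices start at 1,
  so times and cylinder orders are guarded by \<open>1 \<le> n\<close> and series are shifted by \<open>Suc\<close>.
\<close>

definition measure_preserving_map :: "'a measure \<Rightarrow> ('a \<Rightarrow> 'a) \<Rightarrow> bool" where
  "measure_preserving_map M T \<longleftrightarrow> T \<in> measurable M M \<and> distr M M T = M"

definition branch_domains ::
  "'a::metric_space measure \<Rightarrow> ('a \<Rightarrow> 'a) \<Rightarrow> 'i set \<Rightarrow> ('i \<Rightarrow> 'a set) \<Rightarrow> bool" where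
  "branch_domains M T I X \<longleftrightarrow>
     countable I \<and> disjoint_family_on X I \<and>
     (\<forall>i\<in>I. open (X i) \<and> continuous_on (X i) T \<and> inj_on T (X i)) \<and>
     emeasure M (space M - (\<Union>i\<in>I. X i)) = 0"

text \<open>The letter \<open>w k\<close> plays the role of the index with number \<open>k + 1\<close>.\<close>

definition cylinders ::
  "('a \<Rightarrow> 'a) \<Rightarrow> 'i set \<Rightarrow> ('i \<Rightarrow> 'a set) \<Rightarrow> nat \<Rightarrow> 'a set set" where
  "cylinders T I X m = {\<Inter>k<m. (T ^^ k) -` X (w k) | w. \<forall>k<m. w k \<in> I}"

text \<open>
  Values are taken in \<^typ>\<open>ennreal\<close>, so that the infimum over the empty set is infinite.
  The order \<open>m\<close> is an explicit argument because a set does not determine its order as a cylinder.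
\<close>

definition min_expansion :: "('a::metric_space \<Rightarrow> 'a) \<Rightarrow> nat \<Rightarrow> 'a set \<Rightarrow> ennreal" where
  "min_expansion T m J =
     Inf {ennreal (dist ((T ^^ m) x) ((T ^^ m) y) / dist x y) | x y. x \<in> J \<and> y \<in> J \<and> x \<noteq> y}"

text \<open>The power with negative exponent \<open>- s\<close>, for \<open>s > 0\<close>, on the extended half-line.\<close>

definition ennreal_neg_powr :: "ennreal \<Rightarrow> real \<Rightarrow> ennreal" where
  "ennreal_neg_powr K s =
     (if K = \<infinity> then 0 else if K = 0 then \<infinity> else ennreal (enn2real K powr (- s)))"

definition ennreal_ball :: "'a::metric_space \<Rightarrow> ennreal \<Rightarrow> 'a set" where
  "ennreal_ball x R = {y. ennreal (dist x y) < R}"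

definition ahlfors_regular :: "'a::metric_space measure \<Rightarrow> real \<Rightarrow> bool" where
  "ahlfors_regular M \<delta> \<longleftrightarrow>
     (\<exists>\<eta>\<^sub>1>0. \<exists>\<eta>\<^sub>2>0. \<exists>r\<^sub>0>0. \<forall>x r. 0 < r \<and> r < r\<^sub>0 \<longrightarrow>
        \<eta>\<^sub>1 * r powr \<delta> \<le> measure M (ball x r) \<and> measure M (ball x r) \<le> \<eta>\<^sub>2 * r powr \<delta>)"

definition uniformly_mixing :: "'a::metric_space measure \<Rightarrow> ('a \<Rightarrow> 'a) \<Rightarrow> bool" where
  "uniformly_mixing M T \<longleftrightarrow>
     (\<exists>a :: nat \<Rightarrow> real. (\<forall>n\<ge>1. 0 < a n) \<and> summable (\<lambda>n. a (Suc n)) \<and>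
        (\<forall>n\<ge>1. \<forall>x r y s. 0 < r \<and> 0 < s \<longrightarrow>
           \<bar>measure M (ball x r \<inter> (T ^^ n) -` ball y s) - measure M (ball x r) * measure M (ball y s)\<bar>
             \<le> a n * measure M (ball y s)))"

definition bounded_distortion ::
  "('a::metric_space \<Rightarrow> 'a) \<Rightarrow> 'i set \<Rightarrow> ('i \<Rightarrow> 'a set) \<Rightarrow> bool" where
  "bounded_distortion T I X \<longleftrightarrow>
     (\<exists>K\<^sub>1::real. 0 < K\<^sub>1 \<and>
        (\<forall>m\<ge>1. \<forall>J\<in>cylinders T I X m. \<forall>x\<in>J. \<forall>y\<in>J. \<forall>z\<in>J. x \<noteq> y \<and> x \<noteq> z \<longrightarrow>
           (let q = (dist ((T ^^ m) x) ((T ^^ m) y) / dist x y) /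
                    (dist ((T ^^ m) x) ((T ^^ m) z) / dist x z)
            in inverse K\<^sub>1 \<le> q \<and> q \<le> K\<^sub>1)))"

definition expanding ::
  "('a::metric_space \<Rightarrow> 'a) \<Rightarrow> 'i set \<Rightarrow> ('i \<Rightarrow> 'a set) \<Rightarrow> real \<Rightarrow> bool" where
  "expanding T I X \<delta> \<longleftrightarrow>
     (\<lambda>m. INF J\<in>cylinders T I X m. min_expansion T m J) \<longlonglongrightarrow> \<infinity> \<and>
     (SUP m\<in>{1..}. \<Sum>\<^sub>\<infinity>J\<in>cylinders T I X m. ennreal_neg_powr (min_expansion T m J) \<delta>) < \<infinity>"

definition conformal ::
  "('a::metric_space \<Rightarrow> 'a) \<Rightarrow> 'i set \<Rightarrow> ('i \<Rightarrow> 'a set) \<Rightarrow> bool" where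
  "conformal T I X \<longleftrightarrow>
     (\<exists>K\<^sub>2::real. 1 \<le> K\<^sub>2 \<and>
        (\<forall>m\<ge>1. \<forall>J\<in>cylinders T I X m. \<forall>x r. 0 < r \<and> ball x r \<subseteq> J \<longrightarrow>
           ennreal_ball ((T ^^ m) x) (ennreal (inverse K\<^sub>2) * min_expansion T m J * ennreal r)
             \<subseteq> (T ^^ m) ` ball x r \<and>
           (T ^^ m) ` ball x r
             \<subseteq> ennreal_ball ((T ^^ m) x) (ennreal K\<^sub>2 * min_expansion T m J * ennreal r)))"

definition pseudo_markov ::
  "'a measure \<Rightarrow> ('a \<Rightarrow> 'a) \<Rightarrow> 'i set \<Rightarrow> ('i \<Rightarrow> 'a set) \<Rightarrow> bool" where
  "pseudo_markov M T I X \<longleftrightarrow>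
     (\<forall>i\<in>I. T ` X i \<in> sets M) \<and>
     (\<forall>i\<in>I. \<forall>j\<in>I. T ` X i \<inter> X j \<noteq> {} \<longrightarrow> X j \<subseteq> T ` X i) \<and>
     (\<exists>\<tau>>0. \<forall>i\<in>I. \<tau> * measure M (space M) \<le> measure M (T ` X i))"

definition piecewise_lipschitz :: "'a::metric_space measure \<Rightarrow> ('a \<Rightarrow> 'a) \<Rightarrow> bool" where
  "piecewise_lipschitz M f \<longleftrightarrow>
     (\<exists>(N :: nat set) (Y :: nat \<Rightarrow> 'a set) (g :: nat \<Rightarrow> 'a \<Rightarrow> 'a).
        (\<forall>i\<in>N. Y i \<in> sets M \<and> (\<exists>C. C-lipschitz_on UNIV (g i)) \<and> (\<forall>x\<in>Y i. f x = g i x)) \<and>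
        emeasure M (space M - (\<Union>i\<in>N. Y i)) = 0)"

definition recurrence_set ::
  "('a::metric_space \<Rightarrow> 'a) \<Rightarrow> ('a \<Rightarrow> 'a) \<Rightarrow> (nat \<Rightarrow> real) \<Rightarrow> 'a set" where
  "recurrence_set T f \<psi> = {x. \<exists>\<^sub>\<infinity>n. dist ((T ^^ n) x) (f x) < \<psi> n}"

text \<open>
  A piecewise Lipschitz map is unconstrained on a null set, so its recurrence set need not be
  Borel. The measure of this set is therefore to be taken in the completion of the Borel measure
  (\<^const>\<open>measure\<close> is 0 on non-measurable sets).
\<close>

end

theory Submission
  imports Defs
begin

text \<open>
  Call \<open>E n\<close> the set of points with \<open>dist ((T ^^ n) x) (f x) < \<psi> n\<close>. Since \<open>f\<close> agrees with Lipschitz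
  maps on countably many pieces, \<open>f\<close> may be assumed Lipschitz. Mixing, applied at scale \<open>\<psi> n\<close>,
  gives \<open>\<mu> (B \<inter> E n) \<ge> c \<mu> B \<psi> n powr \<delta> - C a n\<close> for every small ball \<open>B\<close>. For the
  correlations with \<open>m < n\<close>, cut \<open>B\<close> into cylinders \<open>J\<close> of order \<open>m\<close>: there \<open>T ^^ m\<close> expands by
  a factor comparable to \<open>K\<^sub>J\<close>, so \<open>J \<inter> E m\<close> has diameter of order \<open>\<psi> m / K\<^sub>J\<close>, inverse branches
  scale measures by at most \<open>K\<^sub>J powr - \<delta>\<close>, and mixing at time \<open>n - m\<close> estimates what is left. The
  pseudo-Markov property gives \<open>K\<^sub>J powr - \<delta> \<le> C \<mu> J\<close>, so summing over the cylinders that meet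
  \<open>B\<close> costs only a factor \<open>C \<mu> B\<close>. The second moment method then yields
  \<open>\<mu> (B \<inter> limsup E) \<ge> c \<mu> B\<close> with \<open>c\<close> independent of \<open>B\<close>, and a density argument finishes.
\<close>

section \<open>Separated nets and regularity of Borel measures\<close>

text \<open>A maximal \<open>s\<close>-separated subset of \<open>A\<close> is a net, since a point
  at distance at least \<open>s\<close> from all of it could be added. Maximality is possible
  because two separated points never share a ball of a finite cover by balls of radius
  \<open>s/2\<close>, which bounds the cardinality.\<close>

lemma separated_net:
  fixes A :: "'a::metric_space set"
  assumes "compact (UNIV :: 'a set)" "0 < s"
  obtains P where "finite P" "P \<subseteq> A" "\<And>p q. p \<in> P \<Longrightarrow> q \<in> P \<Longrightarrow> p \<noteq> q \<Longrightarrow> s \<le> dist p q"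
    "A \<subseteq> (\<Union>p\<in>P. ball p s)"
proof -
  define sep where "sep P \<longleftrightarrow> finite P \<and> P \<subseteq> A \<and> (\<forall>p\<in>P. \<forall>q\<in>P. p \<noteq> q \<longrightarrow> s \<le> dist p q)" for P
  have "x \<in> ball x (s/2)" for x :: 'a using assms(2) by simp
  then have cover: "(UNIV :: 'a set) \<subseteq> (\<Union>k::'a. ball k (s/2))" by blast
  obtain K where "K \<subseteq> UNIV" and K: "finite K" "(UNIV :: 'a set) \<subseteq> (\<Union>k\<in>K. ball k (s/2))"
    by (rule compactE_image[OF assms(1) open_ball cover])
  have card_le: "card P \<le> card K" if "sep P" for P
  proof -
    have "x \<in> (\<Union>k\<in>K. ball k (s/2))" for x using K(2) by (rule subsetD) simp
    then have "\<forall>x. \<exists>k\<in>K. dist k x < s/2" by simp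
    then obtain g where g: "\<And>x. g x \<in> K" "\<And>x. dist (g x) x < s/2" by metis
    have "inj_on g P"
    proof (rule inj_onI, rule ccontr)
      fix x y assume "x \<in> P" "y \<in> P" "g x = g y" "x \<noteq> y"
      then have "s \<le> dist x y" using that by (auto simp: sep_def)
      also have "\<dots> \<le> dist (g x) x + dist (g x) y" by (metis dist_commute dist_triangle)
      finally show False using g(2)[of x] g(2)[of y] \<open>g x = g y\<close> by simp
    qed
    then show ?thesis using card_inj_on_le[of g P K] g(1) K(1) by blast
  qed
  have "sep {}" by (simp add: sep_def)
  then obtain P where P: "sep P" "\<And>P'. sep P' \<Longrightarrow> card P' \<le> card P"
    using ex_has_greatest_nat[of sep "{}" card "Suc (card K)"] card_le by (meson le_imp_less_Suc less_imp_le)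
  have "x \<in> (\<Union>p\<in>P. ball p s)" if "x \<in> A" for x
  proof (rule ccontr)
    assume *: "\<not> ?thesis"
    then have "\<forall>p\<in>P. s \<le> dist p x" by auto
    moreover have "x \<notin> P" using * assms(2) by auto
    ultimately have "sep (insert x P)" using P(1) that by (auto simp: sep_def dist_commute)
    from P(2)[OF this] \<open>x \<notin> P\<close> show False using P(1) by (simp add: sep_def)
  qed
  then have "A \<subseteq> (\<Union>p\<in>P. ball p s)" by (rule subsetI)
  then show thesis using P(1) unfolding sep_def by (intro that[of P]) auto
qed

lemma disjoint_balls_of_separated:
  fixes P :: "'a::metric_space set"
  assumes "\<And>p q. p \<in> P \<Longrightarrow> q \<in> P \<Longrightarrow> p \<noteq> q \<Longrightarrow> 2 * s \<le> dist p q"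
  shows "disjoint_family_on (\<lambda>p. ball p s) P"
proof (unfold disjoint_family_on_def, intro ballI impI, rule ccontr)
  fix p q assume *: "p \<in> P" "q \<in> P" "p \<noteq> q" "ball p s \<inter> ball q s \<noteq> {}"
  then obtain x where "dist p x < s" "dist q x < s" by auto
  moreover have "dist p q \<le> dist p x + dist q x" by (metis dist_commute dist_triangle)
  ultimately show False using assms[OF *(1-3)] by simp
qed

text \<open>The regularity theorems of \<^theory>\<open>HOL-Analysis.Regularity\<close> need the class
  \<^class>\<open>complete_space\<close>, which compactness of the whole type does not provide.\<close>

lemma closed_inner_open_outer:
  fixes M :: "'a::metric_space measure"
  assumes "finite_measure M" and sets_eq: "sets M = sets (borel :: 'a measure)" and A: "A \<in> sets M" and "0 < e"
  shows "\<exists>F U. closed F \<and> open U \<and> F \<subseteq> A \<and> A \<subseteq> U \<and> measure M (U - F) < e"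
proof -
  interpret finite_measure M by fact
  have "A \<in> sigma_sets UNIV {S. open S}"
    using A unfolding sets_eq by (simp add: borel_def)
  have m: "open S \<Longrightarrow> S \<in> sets M" "closed S \<Longrightarrow> S \<in> sets M" for S by (auto simp: sets_eq)
  from \<open>A \<in> sigma_sets UNIV {S. open S}\<close> show ?thesis using \<open>0 < e\<close>
  proof (induction arbitrary: e)
    case (Basic S)
    then have "open S" by simp
    \<comment> \<open>These closed sets exhaust \<open>S\<close>, since a point of an open set has
      positive distance to the complement.\<close>
    define F where "F n = {x. inverse (Suc n) \<le> infdist x (- S)}" for n
    have clF: "closed (F n)" for n
      unfolding F_def by (intro closed_Collect_le continuous_intros)
    show ?case
    \<comment> \<open>\<open>infdist\<close> to the empty set is 0 by convention, so the whole space
      is treated apart.\<close>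
    proof (cases "S = UNIV")
      case True
      then show ?thesis using Basic by (intro exI[of _ UNIV]) auto
    next
      case False
      have empty: "(\<Inter>n. S - F n) = {}"
      proof safe
        fix x assume x: "x \<in> (\<Inter>n. S - F n)"
        then have "x \<in> S" by auto
        then have "infdist x (- S) > 0"
          using \<open>open S\<close> False
          by (metis Compl_UNIV_eq boolean_algebra_class.boolean_algebra.double_compl ComplD closed_Compl
              in_closed_iff_infdist_zero infdist_nonneg less_eq_real_def)
        then obtain n where "inverse (real (Suc n)) < infdist x (- S)"
          using reals_Archimedean by blast
        then show "x \<in> {}" using x less_imp_le by (fastforce simp: F_def simp del: of_nat_Suc)
      qed
      have "decseq (\<lambda>n. S - F n)"
      proof (rule decseq_SucI, rule Diff_mono)
        fix n
        have "inverse (real (Suc (Suc n))) \<le> inverse (real (Suc n))"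
          by (rule le_imp_inverse_le) auto
        then show "F n \<subseteq> F (Suc n)"
          unfolding F_def using order_trans by blast
      qed simp
      moreover have "range (\<lambda>n. S - F n) \<subseteq> sets M"
        using m(1)[OF \<open>open S\<close>] m(2)[OF clF] by blast
      ultimately have "(\<lambda>n. measure M (S - F n)) \<longlonglongrightarrow> 0"
        using finite_Lim_measure_decseq[of "\<lambda>n. S - F n"] by (metis empty measure_empty)
      from order_tendstoD(2)[OF this Basic(2)] obtain n where n: "measure M (S - F n) < e"
        by (auto simp: eventually_sequentially)
      have "F n \<subseteq> S"
      proof
        fix x assume "x \<in> F n"
        then have "inverse (real (Suc n)) \<le> infdist x (- S)" by (simp add: F_def)
        moreover have "0 < inverse (real (Suc n))" by simp
        ultimately have "infdist x (- S) > 0" by linarith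
        then show "x \<in> S" by (metis ComplI infdist_zero less_irrefl)
      qed
      then show ?thesis using n clF \<open>open S\<close> by blast
    qed
  next
    case Empty
    then show ?case by (intro exI[of _ "{}"]) auto
  next
    case (Compl S)
    from Compl.IH[OF \<open>0 < e\<close>] obtain F U where
      "closed F" "open U" "F \<subseteq> S" "S \<subseteq> U" "measure M (U - F) < e" by blast
    moreover have "- F - - U = U - F" by auto
    ultimately show ?case by (intro exI[of _ "- U"] exI[of _ "- F"]) auto
  next
    case (Union S)
    \<comment> \<open>Half of \<open>e\<close> is spread over the sets; the rest is left for cutting
      the union of the closed sets down to a finite one, which is closed.\<close>
    define d where "d n = e / 2 * (1/2) ^ Suc n" for n :: nat
    have d: "d n > 0" for n using Union by (simp add: d_def)
    have dsum: "d sums (e/2)" unfolding d_def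
      using sums_mult[OF power_half_series, of "e/2"] by (simp only: mult_1_right)
    have "\<forall>n. \<exists>F U. closed F \<and> open U \<and> F \<subseteq> S n \<and> S n \<subseteq> U \<and> measure M (U - F) < d n"
      using Union.IH[OF d] by blast
    then obtain F U where FU:
      "\<And>n. closed (F n)" "\<And>n. open (U n)" "\<And>n. F n \<subseteq> S n" "\<And>n. S n \<subseteq> U n"
      "\<And>n. measure M (U n - F n) < d n" by metis
    define G where "G n = (\<Union>i<n. F i)" for n
    define V where "V = (\<Union>i. U i)"
    have clG: "closed (G n)" for n unfolding G_def using FU(1) by auto
    have opV: "open V" unfolding V_def using FU(2) by auto
    have ms: "measure M (V - (\<Union>i. F i)) \<le> e/2"
    proof -
      have sm: "summable (\<lambda>n. measure M (U n - F n))"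
        by (rule summable_comparison_test'[of d 0]) (use FU(5) dsum in \<open>auto simp: sums_iff intro: less_imp_le\<close>)
      have "measure M (V - (\<Union>i. F i)) \<le> measure M (\<Union>n. U n - F n)"
        by (rule finite_measure_mono) (use m FU(1,2) in \<open>auto simp: V_def\<close>)
      also have "\<dots> \<le> (\<Sum>n. measure M (U n - F n))"
        by (rule finite_measure_subadditive_countably) (use m FU(1,2) sm in auto)
      also have "\<dots> \<le> (\<Sum>n. d n)"
        by (rule suminf_le) (use FU(5) sm dsum in \<open>auto simp: sums_iff intro: less_imp_le\<close>)
      finally show ?thesis using dsum by (simp add: sums_iff)
    qed
    have "decseq (\<lambda>n. V - G n)"
      by (rule decseq_SucI) (auto simp: G_def lessThan_Suc)
    moreover have "(\<Inter>n. V - G n) = V - (\<Union>i. F i)" by (auto simp: G_def)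
    moreover have "range (\<lambda>n. V - G n) \<subseteq> sets M" using m(1)[OF opV] m(2)[OF clG] by blast
    ultimately have "(\<lambda>n. measure M (V - G n)) \<longlonglongrightarrow> measure M (V - (\<Union>i. F i))"
      using finite_Lim_measure_decseq[of "\<lambda>n. V - G n"] by simp_all
    moreover have "measure M (V - (\<Union>i. F i)) < e" using ms Union by simp
    ultimately have "\<forall>\<^sub>F n in sequentially. measure M (V - G n) < e"
      by (rule order_tendstoD(2))
    then obtain n where n: "measure M (V - G n) < e"
      by (auto simp: eventually_sequentially)
    show ?case
    proof (intro exI conjI)
      show "G n \<subseteq> (\<Union>i. S i)" "(\<Union>i. S i) \<subseteq> V"
        using FU(3,4) by (fastforce simp: G_def V_def)+
    qed (use n clG opV in auto)
  qed
qed

section \<open>The second moment inequality\<close>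

text \<open>The Chung-Erdos inequality: Cauchy-Schwarz for the indicator of the union and the
  counting function of the events, which vanishes off the union.\<close>

lemma (in prob_space) sum_prob_sq_le:
  fixes A :: "'i \<Rightarrow> 'a set"
  assumes "finite F" and A: "\<And>i. i \<in> F \<Longrightarrow> A i \<in> events"
  shows "(\<Sum>i\<in>F. prob (A i))\<^sup>2 \<le> prob (\<Union>i\<in>F. A i) * (\<Sum>i\<in>F. \<Sum>j\<in>F. prob (A i \<inter> A j))"
proof -
  define U where "U = (\<Union>i\<in>F. A i)"
  define P where "P = (\<Sum>i\<in>F. prob (A i))"
  define Q where "Q = (\<Sum>i\<in>F. \<Sum>j\<in>F. prob (A i \<inter> A j))"
  have U: "U \<in> events" unfolding U_def using assms by auto
  \<comment> \<open>The right-hand side is the expectation of the square of \<open>t\<close> times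
    the indicator of \<open>U\<close> minus the counting function.\<close>
  have *: "0 \<le> t\<^sup>2 * prob U - 2 * t * P + Q" for t
  proof -
    have "(t * indicator U x - (\<Sum>i\<in>F. indicator (A i) x :: real))\<^sup>2
        = t\<^sup>2 * indicator U x - 2 * t * (\<Sum>i\<in>F. indicator (A i) x)
          + (\<Sum>i\<in>F. \<Sum>j\<in>F. indicator (A i \<inter> A j) x)" for x
    proof -
      have s: "(\<Sum>i\<in>F. indicator (A i) x :: real) = indicator U x * (\<Sum>i\<in>F. indicator (A i) x)"
        unfolding sum_distrib_left by (rule sum.cong) (auto simp: indicator_def U_def)
      have "(\<Sum>i\<in>F. \<Sum>j\<in>F. indicator (A i \<inter> A j) x :: real) = (\<Sum>i\<in>F. indicator (A i) x)\<^sup>2"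
        by (simp add: power2_eq_square sum_product indicator_inter_arith)
      moreover have "(indicator U x :: real)\<^sup>2 = indicator U x" by (simp add: indicator_def)
      ultimately show ?thesis
        using s by (simp add: power2_diff power_mult_distrib algebra_simps)
    qed
    moreover have "0 \<le> (\<integral>x. (t * indicator U x - (\<Sum>i\<in>F. indicator (A i) x :: real))\<^sup>2 \<partial>M)"
      by (rule integral_nonneg_AE) simp
    ultimately have "0 \<le> (\<integral>x. t\<^sup>2 * indicator U x - 2 * t * (\<Sum>i\<in>F. indicator (A i) x)
          + (\<Sum>i\<in>F. \<Sum>j\<in>F. indicator (A i \<inter> A j) x) \<partial>M)" by simp
    also have "\<dots> = t\<^sup>2 * prob U - 2 * t * P + Q"
    proof -
      have [simp]: "i \<in> F \<Longrightarrow> integrable M (indicator (A i) :: _ \<Rightarrow> real)"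
        "integrable M (indicator U :: _ \<Rightarrow> real)"
        "i \<in> F \<Longrightarrow> j \<in> F \<Longrightarrow> integrable M (indicator (A i \<inter> A j) :: _ \<Rightarrow> real)" for i j
        using A U by (auto intro!: integrable_real_indicator emeasure_finite simp: less_top[symmetric])
      have [simp]: "space M \<inter> A i \<inter> A j = A i \<inter> A j" "space M \<inter> A i = A i" if "i \<in> F" for i j
        using sets.sets_into_space[OF A[OF that]] by auto
      have [simp]: "A i \<inter> A j \<inter> space M = A i \<inter> A j" "A i \<inter> space M = A i" if "i \<in> F" for i j
        using sets.sets_into_space[OF A[OF that]] by auto
      have [simp]: "U \<inter> space M = U" using sets.sets_into_space[OF U] by auto
      show ?thesis by (simp add: P_def Q_def)
    qed
    finally show ?thesis .
  qed
  have "P\<^sup>2 \<le> prob U * Q"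
  proof (cases "prob U = 0")
    case True
    have "prob (A i) = 0" if "i \<in> F" for i
    proof -
      have "prob (A i) \<le> prob U" by (rule finite_measure_mono) (use that U in \<open>auto simp: U_def\<close>)
      then show ?thesis using True measure_nonneg[of M "A i"] by simp
    qed
    then have "P = 0" by (simp add: P_def)
    then show ?thesis using True by simp
  next
    case False
    then have u: "prob U > 0" by (simp add: zero_less_measure_iff)
    \<comment> \<open>This value of \<open>t\<close> minimises the quadratic polynomial.\<close>
    have "0 \<le> (P / prob U)\<^sup>2 * prob U - 2 * (P / prob U) * P + Q" by (rule *)
    then have "P * P / prob U \<le> Q" using u by (simp add: power2_eq_square field_simps)
    then show ?thesis using u by (simp add: power2_eq_square field_simps)
  qed
  then show ?thesis by (simp add: P_def Q_def U_def)
qed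

section \<open>Ahlfors regular measures\<close>

text \<open>Outer regularity gives an open \<open>U\<close> around \<open>C\<close> of nearly the
  same measure, and compactness gives one radius that works at every point of
  \<open>C\<close>.\<close>

lemma compact_thickening_measure:
  fixes M :: "'a::metric_space measure"
  assumes fin: "finite_measure M" and sets_eq: "sets M = sets (borel :: 'a measure)"
    and "compact C" and "0 < e"
  obtains d where "0 < d" "\<And>s. s \<le> d \<Longrightarrow> measure M (\<Union>x\<in>C. ball x s) < measure M C + e"
proof -
  interpret finite_measure M by fact
  have C: "C \<in> sets M" using \<open>compact C\<close> by (simp add: sets_eq borel_compact)
  obtain F U where U: "open U" "F \<subseteq> C" "C \<subseteq> U" "measure M (U - F) < e" "closed F"
    using closed_inner_open_outer[OF fin sets_eq C \<open>0 < e\<close>] by blast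
  obtain d where d: "d > 0" "(\<Union>x\<in>C. ball x d) \<subseteq> U"
    using compact_subset_open_imp_ball_epsilon_subset[OF \<open>compact C\<close> \<open>open U\<close> \<open>C \<subseteq> U\<close>] by blast
  have sU: "U \<in> sets M" "F \<in> sets M" using U by (auto simp: sets_eq)
  have "measure M (\<Union>x\<in>C. ball x s) < measure M C + e" if "s \<le> d" for s
  proof -
    have "(\<Union>x\<in>C. ball x s) \<subseteq> U" using d(2) that by fastforce
    then have "measure M (\<Union>x\<in>C. ball x s) \<le> measure M U"
      using sU by (intro finite_measure_mono) auto
    also have "measure M U \<le> measure M (C \<union> (U - F))"
      by (rule finite_measure_mono) (use C sU U(2) in auto)
    also have "\<dots> \<le> measure M C + measure M (U - F)"
      by (rule measure_Un_le) (use C sU U(2) in auto)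
    finally show ?thesis using U(4) by simp
  qed
  then show thesis using d(1) that by blast
qed

locale ahlfors_space = prob_space M
  for M :: "'a::{metric_space, second_countable_topology} measure" +
  fixes \<delta> \<eta>\<^sub>1 \<eta>\<^sub>2 r\<^sub>0 :: real
  assumes compact_UNIV: "compact (UNIV :: 'a set)"
    and sets_eq: "sets M = sets borel"
    and pos: "0 < \<delta>" "0 < \<eta>\<^sub>1" "0 < \<eta>\<^sub>2" "0 < r\<^sub>0"
    and ball_lower: "0 < r \<Longrightarrow> r < r\<^sub>0 \<Longrightarrow> \<eta>\<^sub>1 * r powr \<delta> \<le> prob (ball x r)"
    and ball_upper: "0 < r \<Longrightarrow> r < r\<^sub>0 \<Longrightarrow> prob (ball x r) \<le> \<eta>\<^sub>2 * r powr \<delta>"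
begin

lemma space_eq [simp]: "space M = UNIV"
  using sets_eq_imp_space_eq[OF sets_eq] by simp

lemma measurable_open [measurable, simp]: "open S \<Longrightarrow> S \<in> events"
  and measurable_closed: "closed S \<Longrightarrow> S \<in> events"
  and measurable_compact: "compact S \<Longrightarrow> S \<in> events"
  by (auto simp: sets_eq borel_compact)

lemma compact_inner_regular:
  assumes "A \<in> events" "0 < e"
  obtains C where "compact C" "C \<subseteq> A" "prob A < prob C + e"
proof -
  obtain F U where U: "open U" "F \<subseteq> A" "A \<subseteq> U" "prob (U - F) < e" "closed F"
    using closed_inner_open_outer[OF finite_measure_axioms sets_eq assms] by blast
  have "compact F" using compact_Int_closed[OF compact_UNIV \<open>closed F\<close>] by simp
  have "prob A \<le> prob (F \<union> (U - F))" by (rule finite_measure_mono) (use U measurable_closed in auto)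
  also have "\<dots> \<le> prob F + prob (U - F)" by (rule measure_Un_le) (use U measurable_closed in auto)
  finally show thesis using that[of F] U \<open>compact F\<close> by simp
qed

text \<open>A volume count: the balls of radius \<open>s\<close> are disjoint and none is lighter
  than the Ahlfors bound.\<close>

lemma packing:
  assumes "finite P" and sep: "\<And>p q. p \<in> P \<Longrightarrow> q \<in> P \<Longrightarrow> p \<noteq> q \<Longrightarrow> 2 * s \<le> dist p q"
    and "0 < s" "s < r\<^sub>0" and G: "G \<in> events" "(\<Union>p\<in>P. ball p s) \<subseteq> G"
  shows "real (card P) * (\<eta>\<^sub>1 * s powr \<delta>) \<le> prob G"
proof -
  have "real (card P) * (\<eta>\<^sub>1 * s powr \<delta>) = (\<Sum>p\<in>P. \<eta>\<^sub>1 * s powr \<delta>)" by simp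
  also have "\<dots> \<le> (\<Sum>p\<in>P. prob (ball p s))" using assms by (intro sum_mono ball_lower) auto
  also have "\<dots> = prob (\<Union>p\<in>P. ball p s)"
    by (rule finite_measure_finite_Union[symmetric])
       (use assms disjoint_balls_of_separated[OF sep] in auto)
  also have "\<dots> \<le> prob G" using G by (intro finite_measure_mono) auto
  finally show ?thesis .
qed

text \<open>Ahlfors regularity turns measuring into counting. A net of \<open>C\<close> at scale
  \<open>s\<close> has few points, because balls around them pack into a thin neighbourhood of
  \<open>C\<close>, and its image under \<open>h\<close> is a net at scale
  \<open>l * s\<close>.\<close>

lemma lipschitz_image_compact:
  fixes h :: "'a \<Rightarrow> 'a"
  assumes "compact C" and lip: "\<And>x y. x \<in> C \<Longrightarrow> y \<in> C \<Longrightarrow> dist (h x) (h y) \<le> l * dist x y" and "0 < l"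
  shows "prob (h ` C) \<le> \<eta>\<^sub>2 / \<eta>\<^sub>1 * (2 * l) powr \<delta> * prob C"
proof -
  define D where "D = \<eta>\<^sub>2 / \<eta>\<^sub>1 * (2 * l) powr \<delta>"
  have D: "0 < D" using pos \<open>0 < l\<close> by (simp add: D_def)
  have "l-lipschitz_on C h" using lip \<open>0 < l\<close> by (auto simp: lipschitz_on_def)
  then have "continuous_on C h" by (rule lipschitz_on_continuous_on)
  then have hC: "h ` C \<in> events" using \<open>compact C\<close> by (intro measurable_compact compact_continuous_image)
  have "prob (h ` C) \<le> D * prob C"
  proof (rule field_le_epsilon)
    fix e :: real assume "0 < e"
    then have "0 < e / D" using D by simp
    from compact_thickening_measure[OF finite_measure_axioms sets_eq \<open>compact C\<close> this]
    obtain d where d: "0 < d" "\<And>s. s \<le> d \<Longrightarrow> prob (\<Union>x\<in>C. ball x s) < prob C + e / D" by blast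
    \<comment> \<open>Small enough for the ball estimates at both scales \<open>s\<close> and
      \<open>l * s\<close>, and for the thickening of \<open>C\<close>.\<close>
    define s where "s = min d (min (r\<^sub>0 / 2) (r\<^sub>0 / (2 * l)))"
    have s: "0 < s" "s \<le> d" "s < r\<^sub>0" "l * s < r\<^sub>0"
    proof -
      have "s \<le> r\<^sub>0 / (2 * l)" by (simp add: s_def)
      then have "l * s \<le> l * (r\<^sub>0 / (2 * l))" using \<open>0 < l\<close> by (intro mult_left_mono) auto
      also have "\<dots> < r\<^sub>0" using \<open>0 < l\<close> pos by (simp add: field_simps)
      finally show "l * s < r\<^sub>0" .
    qed (use pos d \<open>0 < l\<close> in \<open>auto simp: s_def min_def\<close>)
    obtain P where P: "finite P" "P \<subseteq> C" "\<And>p q. p \<in> P \<Longrightarrow> q \<in> P \<Longrightarrow> p \<noteq> q \<Longrightarrow> s \<le> dist p q"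
      "C \<subseteq> (\<Union>p\<in>P. ball p s)" using separated_net[OF compact_UNIV \<open>0 < s\<close>, of C] by metis
    \<comment> \<open>Disjointness holds for half the radius, which produces the factor 2 in
      \<open>2 * l\<close>.\<close>
    have "real (card P) * (\<eta>\<^sub>1 * (s/2) powr \<delta>) \<le> prob (\<Union>x\<in>C. ball x s)"
    proof (rule packing[OF P(1)])
      show "(\<Union>p\<in>P. ball p (s/2)) \<subseteq> (\<Union>x\<in>C. ball x s)" using P(2) \<open>0 < s\<close> by fastforce
    qed (use P s in \<open>auto intro!: measurable_open\<close>)
    also have "\<dots> \<le> prob C + e / D" using d(2)[of s] s by simp
    finally have card: "real (card P) * (\<eta>\<^sub>1 * (s/2) powr \<delta>) \<le> prob C + e / D" .
    have "h ` C \<subseteq> (\<Union>p\<in>P. ball (h p) (l * s))"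
    proof
      fix y assume "y \<in> h ` C"
      then obtain x where x: "x \<in> C" "y = h x" by auto
      then obtain p where p: "p \<in> P" "dist p x < s" using P(4) by (auto simp: subset_iff)
      have "dist (h p) (h x) \<le> l * dist p x" using lip P(2) p x by auto
      also have "\<dots> < l * s" using p \<open>0 < l\<close> by simp
      finally show "y \<in> (\<Union>p\<in>P. ball (h p) (l * s))" using p x by auto
    qed
    then have "prob (h ` C) \<le> prob (\<Union>p\<in>P. ball (h p) (l * s))"
      by (intro finite_measure_mono measurable_open) auto
    also have "\<dots> \<le> (\<Sum>p\<in>P. prob (ball (h p) (l * s)))"
      by (rule finite_measure_subadditive_finite) (use P in auto)
    also have "\<dots> \<le> (\<Sum>p\<in>P. \<eta>\<^sub>2 * (l * s) powr \<delta>)"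
      by (intro sum_mono ball_upper) (use s \<open>0 < l\<close> in auto)
    also have "\<dots> = D * (real (card P) * (\<eta>\<^sub>1 * (s/2) powr \<delta>))"
    proof -
      have "(l * s) powr \<delta> = (2 * l) powr \<delta> * (s/2) powr \<delta>"
        using s \<open>0 < l\<close> by (simp add: powr_mult[symmetric])
      then show ?thesis using pos by (simp add: D_def field_simps)
    qed
    also have "\<dots> \<le> D * (prob C + e / D)" using card D by (intro mult_left_mono) auto
    also have "\<dots> = D * prob C + e" using D by (simp add: field_simps)
    finally show "prob (h ` C) \<le> D * prob C + e" .
  qed
  then show ?thesis by (simp add: D_def)
qed

text \<open>The inverse branch of \<open>S\<close> on \<open>J\<close> is Lipschitz with constant
  \<open>1 / k\<close>, and inner regularity reduces to a compact \<open>C\<close>, whose image is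
  compact by continuity.\<close>

lemma expanding_preimage:
  fixes S :: "'a \<Rightarrow> 'a"
  assumes J: "J \<in> events" and S: "S \<in> measurable M M" and cont: "continuous_on J S"
    and exp: "\<And>x y. x \<in> J \<Longrightarrow> y \<in> J \<Longrightarrow> k * dist x y \<le> dist (S x) (S y)" and "0 < k"
    and A: "A \<in> events"
  shows "prob (J \<inter> S -` A) \<le> \<eta>\<^sub>2 / \<eta>\<^sub>1 * (2 / k) powr \<delta> * prob A"
proof (rule field_le_epsilon)
  fix e :: real assume "0 < e"
  have m: "J \<inter> S -` A \<in> events" using measurable_sets[OF S A] J by auto
  obtain C where C: "compact C" "C \<subseteq> J \<inter> S -` A" "prob (J \<inter> S -` A) < prob C + e"
    using compact_inner_regular[OF m \<open>0 < e\<close>] by blast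
  have "compact (S ` C)" using C continuous_on_subset[OF cont] by (intro compact_continuous_image) auto
  have inj: "inj_on S C"
  proof (rule inj_onI)
    fix x y assume "x \<in> C" "y \<in> C" "S x = S y"
    then have "k * dist x y \<le> 0" using exp[of x y] C(2) by auto
    then show "x = y" using \<open>0 < k\<close> by (simp add: mult_le_0_iff)
  qed
  have "prob (inv_into C S ` (S ` C)) \<le> \<eta>\<^sub>2 / \<eta>\<^sub>1 * (2 * (1 / k)) powr \<delta> * prob (S ` C)"
  proof (rule lipschitz_image_compact[OF \<open>compact (S ` C)\<close>])
    fix x y assume "x \<in> S ` C" "y \<in> S ` C"
    then obtain u v where "u \<in> C" "v \<in> C" "x = S u" "y = S v" by auto
    then show "dist (inv_into C S x) (inv_into C S y) \<le> 1 / k * dist x y"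
      using exp[of u v] C(2) inj \<open>0 < k\<close> by (auto simp: inv_into_f_f field_simps)
  qed (use \<open>0 < k\<close> in auto)
  also have "inv_into C S ` (S ` C) = C" using inj by simp
  finally have "prob C \<le> \<eta>\<^sub>2 / \<eta>\<^sub>1 * (2 / k) powr \<delta> * prob (S ` C)" by simp
  also have "\<dots> \<le> \<eta>\<^sub>2 / \<eta>\<^sub>1 * (2 / k) powr \<delta> * prob A"
    using C(2) A pos by (intro mult_left_mono finite_measure_mono) auto
  finally show "prob (J \<inter> S -` A) \<le> \<eta>\<^sub>2 / \<eta>\<^sub>1 * (2 / k) powr \<delta> * prob A + e"
    using C(3) by simp
qed

text \<open>The constant comes from \<open>lip\<close>; \<open>exp\<close> makes the inverse
  Lipschitz, so that a compact subset of the image pulls back to a compact subset of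
  \<open>J\<close>.\<close>

lemma bilipschitz_image:
  fixes S :: "'a \<Rightarrow> 'a"
  assumes J: "J \<in> events" and SJ: "S ` J \<in> events"
    and exp: "\<And>x y. x \<in> J \<Longrightarrow> y \<in> J \<Longrightarrow> k * dist x y \<le> dist (S x) (S y)" and "0 < k"
    and lip: "\<And>x y. x \<in> J \<Longrightarrow> y \<in> J \<Longrightarrow> dist (S x) (S y) \<le> l * dist x y" and "0 < l"
  shows "prob (S ` J) \<le> \<eta>\<^sub>2 / \<eta>\<^sub>1 * (2 * l) powr \<delta> * prob J"
proof (rule field_le_epsilon)
  fix e :: real assume "0 < e"
  obtain C where C: "compact C" "C \<subseteq> S ` J" "prob (S ` J) < prob C + e"
    using compact_inner_regular[OF SJ \<open>0 < e\<close>] by blast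
  have inj: "inj_on S J"
  proof (rule inj_onI)
    fix x y assume "x \<in> J" "y \<in> J" "S x = S y"
    then have "k * dist x y \<le> 0" using exp[of x y] by auto
    then show "x = y" using \<open>0 < k\<close> by (simp add: mult_le_0_iff)
  qed
  define g where "g = inv_into J S"
  have g: "g x \<in> J" "S (g x) = x" if "x \<in> C" for x
    using that C(2) by (auto simp: g_def f_inv_into_f inv_into_into subset_iff)
  have "(1/k)-lipschitz_on C g"
  proof (rule lipschitz_onI)
    fix x y assume "x \<in> C" "y \<in> C"
    then show "dist (g x) (g y) \<le> 1 / k * dist x y"
      using exp[OF g(1) g(1), of x y] g(2) \<open>0 < k\<close> by (simp add: field_simps)
  qed (use \<open>0 < k\<close> in simp)
  then have "compact (g ` C)" using C(1) by (intro compact_continuous_image lipschitz_on_continuous_on)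
  have "S ` g ` C = C" using g by force
  moreover have "prob (S ` g ` C) \<le> \<eta>\<^sub>2 / \<eta>\<^sub>1 * (2 * l) powr \<delta> * prob (g ` C)"
    by (rule lipschitz_image_compact[OF \<open>compact (g ` C)\<close>]) (use lip g \<open>0 < l\<close> in auto)
  moreover have "\<dots> \<le> \<eta>\<^sub>2 / \<eta>\<^sub>1 * (2 * l) powr \<delta> * prob J"
    using g(1) J pos by (intro mult_left_mono finite_measure_mono) auto
  ultimately show "prob (S ` J) \<le> \<eta>\<^sub>2 / \<eta>\<^sub>1 * (2 * l) powr \<delta> * prob J + e" using C(3) by simp
qed

text \<open>A substitute for the Lebesgue density theorem: if the complement of \<open>R\<close> had a compact subset
  \<open>C\<close> of positive measure, then a fixed proportion of a thin neighbourhood of \<open>C\<close> would lie in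
  \<open>R\<close>, although the neighbourhoods shrink to \<open>C\<close>.\<close>

lemma prob_eq_1_if_dense:
  assumes R: "R \<in> events" and "0 < c" "0 < r\<^sub>1"
    and dens: "\<And>x r. 0 < r \<Longrightarrow> r < r\<^sub>1 \<Longrightarrow> c * prob (ball x r) \<le> prob (ball x r \<inter> R)"
  shows "prob R = 1"
proof (rule ccontr)
  assume "prob R \<noteq> 1"
  then have "prob (- R) > 0" using prob_compl[OF R] prob_le_1[of R] by (simp add: Compl_eq_Diff_UNIV less_le)
  moreover have "- R \<in> events" using sets.compl_sets[OF R] by (simp add: Compl_eq_Diff_UNIV)
  \<comment> \<open>Taking \<open>prob (- R)\<close> itself as the error forces \<open>C\<close> to
    have positive measure.\<close>
  ultimately obtain C where C: "compact C" "C \<subseteq> - R" "prob (- R) < prob C + prob (- R)"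
    using compact_inner_regular[of "- R" "prob (- R)"] by blast
  then have pC: "prob C > 0" by simp
  have mC: "C \<in> events" using C measurable_compact by simp
  \<comment> \<open>\<open>\<eta>\<^sub>2 / \<eta>\<^sub>1 * 2 powr \<delta>\<close> is the loss in
    passing from a cover of \<open>C\<close> by balls of radius \<open>s\<close> to the disjoint
    balls of radius \<open>s/2\<close>.\<close>
  define c' where "c' = c * (\<eta>\<^sub>1 / \<eta>\<^sub>2 / 2 powr \<delta>)"
  have c': "c' > 0" using \<open>0 < c\<close> pos by (simp add: c'_def)
  obtain d where d: "0 < d" "\<And>s. s \<le> d \<Longrightarrow> prob (\<Union>x\<in>C. ball x s) < prob C + c' * prob C"
    using compact_thickening_measure[OF finite_measure_axioms sets_eq C(1), of "c' * prob C"] c' pC by auto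
  define s where "s = min d (min (r\<^sub>0 / 2) r\<^sub>1)"
  have s: "0 < s" "s \<le> d" "s < r\<^sub>0" "s \<le> r\<^sub>1" using d pos \<open>0 < r\<^sub>1\<close> by (auto simp: s_def min_def)
  obtain P where P: "finite P" "P \<subseteq> C" "\<And>p q. p \<in> P \<Longrightarrow> q \<in> P \<Longrightarrow> p \<noteq> q \<Longrightarrow> s \<le> dist p q"
    "C \<subseteq> (\<Union>p\<in>P. ball p s)" using separated_net[OF compact_UNIV \<open>0 < s\<close>, of C] by metis
  have "prob C \<le> prob (\<Union>p\<in>P. ball p s)" using P(4) by (intro finite_measure_mono measurable_open) auto
  also have "\<dots> \<le> (\<Sum>p\<in>P. prob (ball p s))"
    by (rule finite_measure_subadditive_finite) (use P in auto)
  also have "\<dots> \<le> (\<Sum>p\<in>P. \<eta>\<^sub>2 * s powr \<delta>)" by (intro sum_mono ball_upper) (use s in auto)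
  also have "\<dots> = \<eta>\<^sub>2 / \<eta>\<^sub>1 * 2 powr \<delta> * (\<Sum>p\<in>P. \<eta>\<^sub>1 * (s/2) powr \<delta>)"
    using pos s by (simp add: powr_divide field_simps)
  also have "\<dots> \<le> \<eta>\<^sub>2 / \<eta>\<^sub>1 * 2 powr \<delta> * (\<Sum>p\<in>P. prob (ball p (s/2)))"
    using pos s by (intro mult_left_mono sum_mono ball_lower) auto
  finally have "c' * prob C \<le> c' * (\<eta>\<^sub>2 / \<eta>\<^sub>1 * 2 powr \<delta> * (\<Sum>p\<in>P. prob (ball p (s/2))))"
    using c' by (intro mult_left_mono) auto
  also have "\<dots> = (\<Sum>p\<in>P. c * prob (ball p (s/2)))"
    using pos by (simp add: c'_def sum_distrib_left field_simps)
  also have "\<dots> \<le> (\<Sum>p\<in>P. prob (ball p (s/2) \<inter> R))" using s by (intro sum_mono dens) auto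
  also have "\<dots> = prob (\<Union>p\<in>P. ball p (s/2) \<inter> R)"
  proof (rule finite_measure_finite_Union[symmetric])
    have "disjoint_family_on (\<lambda>p. ball p (s/2)) P" by (rule disjoint_balls_of_separated) (use P in auto)
    then show "disjoint_family_on (\<lambda>p. ball p (s/2) \<inter> R) P" by (auto simp: disjoint_family_on_def)
  qed (use P R in auto)
  \<comment> \<open>\<open>C\<close> avoids \<open>R\<close>, so these pieces lie in the thickening
    of \<open>C\<close> but outside \<open>C\<close>, where less than \<open>c' * prob C\<close> is
    available.\<close>
  also have "\<dots> \<le> prob ((\<Union>x\<in>C. ball x s) - C)"
  proof (rule finite_measure_mono)
    show "(\<Union>p\<in>P. ball p (s/2) \<inter> R) \<subseteq> (\<Union>x\<in>C. ball x s) - C"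
      using P(2) C(2) s(1) by fastforce
  qed (intro sets.Diff measurable_open mC, auto)
  also have "\<dots> = prob (\<Union>x\<in>C. ball x s) - prob C"
  proof (rule finite_measure_Diff)
    show "C \<subseteq> (\<Union>x\<in>C. ball x s)" using s(1) by force
  qed (auto simp: mC intro: measurable_open)
  also have "\<dots> < c' * prob C" using d(2)[of s] s by simp
  finally show False by simp
qed

end

section \<open>Hitting events\<close>

text \<open>The setting with \<open>f\<close> Lipschitz. \<open>a\<close> is nonnegative at index 0
  too, so that its full sum bounds every finite one.\<close>

locale twisted_recurrence = ahlfors_space M \<delta> \<eta>\<^sub>1 \<eta>\<^sub>2 r\<^sub>0
  for M :: "'a::{metric_space, second_countable_topology} measure" and \<delta> \<eta>\<^sub>1 \<eta>\<^sub>2 r\<^sub>0 +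
  fixes T f :: "'a \<Rightarrow> 'a" and a \<psi> :: "nat \<Rightarrow> real" and L :: real
  assumes T_meas [measurable]: "T \<in> measurable M M"
    and a_nonneg: "0 \<le> a n" and a_summable: "summable a"
    and mixing: "1 \<le> n \<Longrightarrow> 0 < r \<Longrightarrow> 0 < s \<Longrightarrow>
      \<bar>prob (ball x r \<inter> (T ^^ n) -` ball y s) - prob (ball x r) * prob (ball y s)\<bar> \<le> a n * prob (ball y s)"
    and f_lip: "L-lipschitz_on UNIV f"
    and \<psi>_pos: "1 \<le> n \<Longrightarrow> 0 < \<psi> n"
    and \<psi>_lim: "\<psi> \<longlonglongrightarrow> 0"
    and \<psi>_div: "\<not> summable (\<lambda>n. \<psi> n powr \<delta>)"
begin

definition hits :: "nat \<Rightarrow> 'a set" where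
  "hits n = {x. dist ((T ^^ n) x) (f x) < \<psi> n}"

lemma L_nonneg: "0 \<le> L"
  using f_lip by (simp add: lipschitz_on_def)

lemma f_dist: "dist (f x) (f y) \<le> L * dist x y"
  using f_lip by (simp add: lipschitz_on_def)

lemma iterate_measurable [measurable]: "(T ^^ n) \<in> measurable M M"
  by (induction n) (auto intro: measurable_comp[OF _ T_meas])

lemma vimage_iterate: "A \<in> events \<Longrightarrow> (T ^^ n) -` A \<in> events"
  using measurable_sets[OF iterate_measurable, of A n] by simp

lemma hits_measurable [measurable]: "hits n \<in> events"
proof -
  have [measurable]: "f \<in> measurable M borel"
    using lipschitz_on_continuous_on[OF f_lip] borel_measurable_continuous_onI
    by (simp add: sets_eq cong: measurable_cong_sets)
  have [measurable]: "(T ^^ n) \<in> measurable M borel"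
    using iterate_measurable[of n] sets_eq measurable_cong_sets by blast
  have "{x \<in> space M. dist ((T ^^ n) x) (f x) < \<psi> n} \<in> events" by measurable
  then show ?thesis by (simp add: hits_def)
qed

lemma mixing_upper:
  "1 \<le> n \<Longrightarrow> 0 < r \<Longrightarrow> 0 < s \<Longrightarrow> prob (ball x r \<inter> (T ^^ n) -` ball y s) \<le> (prob (ball x r) + a n) * prob (ball y s)"
  using mixing[of n r s x y] by (simp add: algebra_simps)

lemma mixing_lower:
  "1 \<le> n \<Longrightarrow> 0 < r \<Longrightarrow> 0 < s \<Longrightarrow> (prob (ball x r) - a n) * prob (ball y s) \<le> prob (ball x r \<inter> (T ^^ n) -` ball y s)"
  using mixing[of n r s x y] by (simp add: algebra_simps)

lemma \<psi>_eventually_small: "0 < e \<Longrightarrow> \<forall>\<^sub>F n in sequentially. \<psi> n < e"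
  using order_tendstoD(2)[OF \<psi>_lim] .

text \<open>Fill the ball with disjoint balls of radius \<open>s\<close> comparable to
  \<open>\<psi> n\<close>. On each, \<open>f\<close> is almost constant, so a hit is guaranteed when
  \<open>T ^^ n\<close> lands in a fixed ball, and mixing measures this. The number of balls is at
  most of order \<open>s powr (- \<delta>)\<close>, so the mixing errors add up to order
  \<open>a n\<close>.\<close>

lemma hits_ball_lower:
  obtains c C where "0 < c" "0 \<le> C"
    "\<And>x R. 0 < R \<Longrightarrow> R < r\<^sub>0 \<Longrightarrow> \<forall>\<^sub>F n in sequentially.
       c * prob (ball x R) * \<psi> n powr \<delta> - C * a n \<le> prob (ball x R \<inter> hits n)"
proof -
  \<comment> \<open>With \<open>s = \<psi> n / l\<close> this gives
    \<open>(L + 1) * s = \<psi> n / 4\<close>, so the variation of \<open>f\<close> on a ball of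
    radius \<open>s\<close> stays below half of \<open>\<psi> n\<close>.\<close>
  define l where "l = 4 * (L + 1)"
  have l: "4 \<le> l" using L_nonneg by (simp add: l_def)
  \<comment> \<open>The factor in \<open>N2\<close>, times \<open>\<eta>\<^sub>1\<^sup>2\<close>
    from two ball estimates, times the loss from halving \<open>\<psi> n\<close>.\<close>
  define c where "c = \<eta>\<^sub>1 / \<eta>\<^sub>2\<^sup>2 / 4 powr \<delta> * \<eta>\<^sub>1\<^sup>2 / 2 powr \<delta>"
  define C where "C = \<eta>\<^sub>2 * ((l/2) powr \<delta> / \<eta>\<^sub>1)"
  show thesis
  proof (rule that[of c C])
    show "0 < c" "0 \<le> C" using pos l by (auto simp: c_def C_def)
    fix z R assume R: "0 < R" "R < r\<^sub>0"
    have "\<forall>\<^sub>F n in sequentially. \<psi> n < R" using R by (intro \<psi>_eventually_small)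
    moreover have "\<forall>\<^sub>F n in sequentially. (1::nat) \<le> n" by (rule eventually_ge_at_top)
    ultimately show "\<forall>\<^sub>F n in sequentially.
       c * prob (ball z R) * \<psi> n powr \<delta> - C * a n \<le> prob (ball z R \<inter> hits n)"
    proof eventually_elim
      case (elim n)
      define s where "s = \<psi> n / l"
      have \<psi>: "0 < \<psi> n" using elim \<psi>_pos by simp
      have s: "0 < s" using l \<psi> by (simp add: s_def)
      have s4: "s \<le> \<psi> n / 4" unfolding s_def using l \<psi> by (intro divide_left_mono) auto
      have Ls: "L * s \<le> \<psi> n / 2 - s"
      proof -
        have "L * s + s = s * (l / 4)" by (simp add: l_def algebra_simps)
        also have "\<dots> = \<psi> n / 4" using l by (simp add: s_def)
        finally have "L * s + s = \<psi> n / 4" .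
        then show ?thesis using \<psi> by simp
      qed
      \<comment> \<open>The net lives in the half ball so that balls of radius \<open>s\<close>
        around it stay inside \<open>ball z R\<close>.\<close>
      obtain P where P: "finite P" "P \<subseteq> ball z (R/2)"
        "\<And>p q. p \<in> P \<Longrightarrow> q \<in> P \<Longrightarrow> p \<noteq> q \<Longrightarrow> 2 * s \<le> dist p q"
        "ball z (R/2) \<subseteq> (\<Union>p\<in>P. ball p (2 * s))"
        using separated_net[OF compact_UNIV, of "2 * s" "ball z (R/2)"] s by (metis zero_less_mult_iff zero_less_numeral)
      \<comment> \<open>Up to constants, the total mass of the disjoint balls. \<open>N1\<close>
        bounds it by the mass of the space, \<open>N2\<close> from below, because the balls of
        doubled radius cover the half ball.\<close>
      define N where "N = real (card P) * s powr \<delta>"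
      have N1: "N * \<eta>\<^sub>1 \<le> 1"
        using packing[OF P(1,3), of UNIV] s s4 R elim prob_space by (simp add: N_def mult_ac)
      have N2: "\<eta>\<^sub>1 / \<eta>\<^sub>2\<^sup>2 / 4 powr \<delta> * prob (ball z R) \<le> N"
      proof -
        have "\<eta>\<^sub>1 * (R/2) powr \<delta> \<le> prob (ball z (R/2))" using R by (intro ball_lower) auto
        also have "\<dots> \<le> prob (\<Union>p\<in>P. ball p (2 * s))" using P(4) by (intro finite_measure_mono measurable_open) auto
        also have "\<dots> \<le> (\<Sum>p\<in>P. prob (ball p (2 * s)))"
          by (rule finite_measure_subadditive_finite) (use P in auto)
        also have "\<dots> \<le> (\<Sum>p\<in>P. \<eta>\<^sub>2 * (2 * s) powr \<delta>)"
          by (intro sum_mono ball_upper) (use s s4 R elim in auto)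
        also have "\<dots> = \<eta>\<^sub>2 * 2 powr \<delta> * N" using s by (simp add: N_def powr_mult)
        finally have 1: "\<eta>\<^sub>1 * (R/2) powr \<delta> \<le> \<eta>\<^sub>2 * 2 powr \<delta> * N" .
        have "(4::real) powr \<delta> = 2 powr \<delta> * 2 powr \<delta>" by (simp add: powr_mult[symmetric])
        then have "\<eta>\<^sub>1 / \<eta>\<^sub>2\<^sup>2 / 4 powr \<delta> * prob (ball z R) \<le> \<eta>\<^sub>1 / \<eta>\<^sub>2\<^sup>2 / (2 powr \<delta> * 2 powr \<delta>) * (\<eta>\<^sub>2 * R powr \<delta>)"
          using pos ball_upper[OF R] by (simp add: divide_right_mono mult_left_mono)
        also have "\<dots> = (\<eta>\<^sub>1 * (R/2) powr \<delta>) / (\<eta>\<^sub>2 * 2 powr \<delta>)"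
          using pos R by (simp add: powr_divide power2_eq_square field_simps)
        also have "\<dots> \<le> N" using 1 pos by (simp add: field_simps)
        finally show ?thesis .
      qed
      define h where "h = (\<psi> n / 2) powr \<delta>"
      have h: "0 \<le> h" by (simp add: h_def)
      have piece: "\<eta>\<^sub>1\<^sup>2 * s powr \<delta> * h - \<eta>\<^sub>2 * h * a n \<le> prob (ball p s \<inter> (T ^^ n) -` ball (f p) (\<psi> n / 2))" for p
      proof -
        have "\<eta>\<^sub>1\<^sup>2 * s powr \<delta> * h = (\<eta>\<^sub>1 * s powr \<delta>) * (\<eta>\<^sub>1 * h)" by (simp add: power2_eq_square)
        also have "\<dots> \<le> prob (ball p s) * prob (ball (f p) (\<psi> n / 2))"
          unfolding h_def using s s4 R elim \<psi> pos by (intro mult_mono ball_lower) auto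
        finally have 1: "\<eta>\<^sub>1\<^sup>2 * s powr \<delta> * h \<le> prob (ball p s) * prob (ball (f p) (\<psi> n / 2))" .
        have "a n * prob (ball (f p) (\<psi> n / 2)) \<le> a n * (\<eta>\<^sub>2 * h)"
          unfolding h_def using R elim \<psi> a_nonneg by (intro mult_left_mono ball_upper) auto
        with 1 mixing_lower[of n s "\<psi> n / 2" p "f p"] elim s \<psi> show ?thesis by (simp add: algebra_simps)
      qed
      have "\<eta>\<^sub>1\<^sup>2 * h * N - \<eta>\<^sub>2 * h * a n * real (card P) = (\<Sum>p\<in>P. \<eta>\<^sub>1\<^sup>2 * s powr \<delta> * h - \<eta>\<^sub>2 * h * a n)"
        by (simp add: N_def algebra_simps)
      also have "\<dots> \<le> (\<Sum>p\<in>P. prob (ball p s \<inter> (T ^^ n) -` ball (f p) (\<psi> n / 2)))"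
        by (intro sum_mono piece)
      also have "\<dots> = prob (\<Union>p\<in>P. ball p s \<inter> (T ^^ n) -` ball (f p) (\<psi> n / 2))"
      proof (rule finite_measure_finite_Union[symmetric])
        have "disjoint_family_on (\<lambda>p. ball p s) P" by (rule disjoint_balls_of_separated) (use P in auto)
        then show "disjoint_family_on (\<lambda>p. ball p s \<inter> (T ^^ n) -` ball (f p) (\<psi> n / 2)) P"
          by (auto simp: disjoint_family_on_def)
      qed (use P vimage_iterate in auto)
      also have "\<dots> \<le> prob (ball z R \<inter> hits n)"
      proof (rule finite_measure_mono)
        show "(\<Union>p\<in>P. ball p s \<inter> (T ^^ n) -` ball (f p) (\<psi> n / 2)) \<subseteq> ball z R \<inter> hits n"
        proof clarify
          fix p x assume p: "p \<in> P" and x: "x \<in> ball p s" "(T ^^ n) x \<in> ball (f p) (\<psi> n / 2)"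
          have "dist z x \<le> dist z p + dist p x" by (rule dist_triangle)
          also have "\<dots> < R" using x p P(2) s s4 elim by (auto simp: subset_iff)
          finally have "x \<in> ball z R" by simp
          moreover have "dist ((T ^^ n) x) (f x) < \<psi> n"
          proof -
            have "dist ((T ^^ n) x) (f x) \<le> dist (f p) ((T ^^ n) x) + dist (f p) (f x)"
              by (metis dist_commute dist_triangle)
            also have "dist (f p) (f x) \<le> L * dist p x" by (rule f_dist)
            also have "\<dots> \<le> L * s" using x L_nonneg by (intro mult_left_mono) auto
            finally show ?thesis using Ls x s by simp
          qed
          ultimately show "x \<in> ball z R \<inter> hits n" by (simp add: hits_def)
        qed
      qed auto
      finally have main: "\<eta>\<^sub>1\<^sup>2 * h * N - \<eta>\<^sub>2 * h * a n * real (card P) \<le> prob (ball z R \<inter> hits n)" .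
      \<comment> \<open>\<open>h\<close> and \<open>s powr \<delta>\<close> have a fixed ratio, so
        by \<open>N1\<close> this product is bounded independently of \<open>n\<close>, which
        controls the total mixing error.\<close>
      have "h * real (card P) = (l/2) powr \<delta> * N"
      proof -
        have "\<psi> n / 2 = (l/2) * s" using l by (simp add: s_def)
        then have "h = (l/2) powr \<delta> * s powr \<delta>" unfolding h_def by (simp only: powr_mult)
        then show ?thesis by (simp add: N_def)
      qed
      also have "\<dots> \<le> (l/2) powr \<delta> * (1 / \<eta>\<^sub>1)"
        using N1 pos by (intro mult_left_mono) (auto simp: field_simps)
      finally have "\<eta>\<^sub>2 * a n * (h * real (card P)) \<le> \<eta>\<^sub>2 * a n * ((l/2) powr \<delta> * (1 / \<eta>\<^sub>1))"
        using pos a_nonneg by (intro mult_left_mono) auto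
      also have "\<dots> = C * a n" by (simp add: C_def)
      finally have "\<eta>\<^sub>2 * h * a n * real (card P) \<le> C * a n" by (simp add: mult_ac)
      moreover have "c * prob (ball z R) * \<psi> n powr \<delta> \<le> \<eta>\<^sub>1\<^sup>2 * h * N"
      proof -
        have "c * prob (ball z R) * \<psi> n powr \<delta> = \<eta>\<^sub>1\<^sup>2 * h * (\<eta>\<^sub>1 / \<eta>\<^sub>2\<^sup>2 / 4 powr \<delta> * prob (ball z R))"
          using \<psi> by (simp add: c_def h_def powr_divide mult_ac)
        also have "\<dots> \<le> \<eta>\<^sub>1\<^sup>2 * h * N" using N2 h by (intro mult_left_mono) auto
        finally show ?thesis .
      qed
      ultimately show ?case using main by linarith
    qed
  qed
qed

end

section \<open>Correlations of two hitting events\<close>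

text \<open>Countable additivity over a partition modulo a null set. In the application
  \<open>W\<close> is a doubled ball, which contains every cell that meets \<open>G\<close>.\<close>

lemma (in prob_space) prob_le_via_partition:
  assumes F: "countable \<F>" "disjoint \<F>" "\<F> \<subseteq> events" "prob (\<Union>\<F>) = 1"
    and GW: "G \<in> events" "W \<in> events" and "0 \<le> c"
    and le: "\<And>J. J \<in> \<F> \<Longrightarrow> prob (G \<inter> J) \<le> c * prob (J \<inter> W)"
  shows "prob G \<le> c * prob W"
proof -
  have UF: "\<Union>\<F> \<in> events" using F by (simp add: sets.countable_Union)
  have disj: "disjoint_family_on (\<lambda>J. H \<inter> J) \<F>" for H
    using F(2) by (auto simp: disjoint_family_on_def disjoint_def)
  have "AE x in M. x \<in> \<Union>\<F>" using prob_eq_1[OF UF] F(4) by simp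
  then have "emeasure M G = emeasure M (\<Union>J\<in>\<F>. G \<inter> J)"
    using F(3) GW UF by (intro emeasure_eq_AE) (auto simp: Int_UN_distrib[symmetric] simp flip: Int_Union)
  also have "\<dots> = (\<integral>\<^sup>+J. emeasure M (G \<inter> J) \<partial>count_space \<F>)"
    using F GW disj by (intro emeasure_UN_countable) auto
  also have "\<dots> \<le> (\<integral>\<^sup>+J. ennreal c * emeasure M (W \<inter> J) \<partial>count_space \<F>)"
    using le \<open>0 \<le> c\<close> by (intro nn_integral_mono)
      (auto simp: emeasure_eq_measure ennreal_mult[symmetric] Int_commute intro!: ennreal_leI)
  also have "\<dots> = ennreal c * (\<integral>\<^sup>+J. emeasure M (W \<inter> J) \<partial>count_space \<F>)"
    by (rule nn_integral_cmult) simp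
  also have "(\<integral>\<^sup>+J. emeasure M (W \<inter> J) \<partial>count_space \<F>) = emeasure M (\<Union>J\<in>\<F>. W \<inter> J)"
    using F GW disj by (intro emeasure_UN_countable[symmetric]) auto
  also have "ennreal c * \<dots> \<le> ennreal c * emeasure M W"
    using GW by (intro mult_left_mono emeasure_mono) auto
  finally show ?thesis using \<open>0 \<le> c\<close> by (simp add: emeasure_eq_measure ennreal_mult[symmetric] ennreal_le_iff)
qed

context twisted_recurrence
begin

text \<open>A hit at time \<open>m\<close> confines the point to a part of \<open>J\<close> of
  diameter of order \<open>\<psi> m / K\<close>. On each ball of a net of that part,
  \<open>T ^^ m\<close> stays in a ball of radius \<open>Q * K * s\<close>, and a hit at time
  \<open>n\<close> sends that image, \<open>n - m\<close> steps later, close to a fixed point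
  \<open>f p\<close>. Mixing measures such visits, and \<open>expanding_preimage\<close> pulls the
  estimate back to \<open>J\<close>.\<close>

lemma hits_pair_upper:
  assumes J: "J \<in> events" and cont: "continuous_on J (T ^^ m)"
    and mn: "1 \<le> m" "m < n"
    and K: "1 \<le> K" "2 * L \<le> K" and Q: "1 \<le> Q"
    and exp: "\<And>x y. x \<in> J \<Longrightarrow> y \<in> J \<Longrightarrow> K * dist x y \<le> dist ((T ^^ m) x) ((T ^^ m) y)"
    and lip: "\<And>x y. x \<in> J \<Longrightarrow> y \<in> J \<Longrightarrow> dist ((T ^^ m) x) ((T ^^ m) y) \<le> Q * K * dist x y"
    and small: "Q * \<psi> m < r\<^sub>0" "5 * \<psi> m < r\<^sub>0" "(1 + L) * \<psi> n < r\<^sub>0"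
  shows "prob (J \<inter> (hits m \<inter> hits n)) \<le>
    ((\<eta>\<^sub>2 / \<eta>\<^sub>1)\<^sup>2 * 2 powr \<delta> * 10 powr \<delta> * \<eta>\<^sub>2 * (1 + L) powr \<delta> * (\<eta>\<^sub>2 * Q powr \<delta> + 1)) * K powr (- \<delta>) *
    (\<psi> m powr \<delta> * \<psi> n powr \<delta> + a (n - m) * (\<psi> m powr \<delta> + \<psi> n powr \<delta>))"
    (is "_ \<le> ?D * _ * (?p * ?q + ?a * _)")
\<comment> \<open>A point of \<open>J \<inter> hits m\<close> is needed as the centre of the packing
  below.\<close>
proof (cases "J \<inter> hits m = {}")
  case True
  then have "J \<inter> (hits m \<inter> hits n) = {}" by auto
  then show ?thesis using pos a_nonneg L_nonneg by (simp only: measure_empty) (intro mult_nonneg_nonneg add_nonneg_nonneg, auto)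
next
  case False
  then obtain y\<^sub>1 where y1: "y\<^sub>1 \<in> J \<inter> hits m" by auto
  have \<psi>: "0 < \<psi> m" "0 < \<psi> n" using mn \<psi>_pos by auto
  \<comment> \<open>The first bound keeps the images of net balls under \<open>T ^^ m\<close> at
    scale \<open>\<psi> m\<close>, the second lets \<open>f\<close> vary by at most
    \<open>L * \<psi> n\<close> on a net ball.\<close>
  define s where "s = min (\<psi> m / K) (\<psi> n)"
  have s: "0 < s" "s \<le> \<psi> m / K" "s \<le> \<psi> n" using \<psi> K by (auto simp: s_def)
  have Ks: "K * s \<le> \<psi> m" using s(2) K by (simp add: field_simps)
  have mK: "\<psi> m / K \<le> \<psi> m" using K \<psi> by (simp add: field_simps)
  have diam: "dist x y \<le> 4 * (\<psi> m / K)" if "x \<in> J \<inter> hits m" "y \<in> J \<inter> hits m" for x y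
  proof -
    have "K * dist x y \<le> dist ((T ^^ m) x) ((T ^^ m) y)" using exp that by auto
    also have "\<dots> \<le> dist ((T ^^ m) x) (f x) + dist (f x) (f y) + dist ((T ^^ m) y) (f y)"
      by (smt (verit) dist_commute dist_triangle)
    also have "\<dots> \<le> 2 * \<psi> m + L * dist x y" using that f_dist[of x y] by (auto simp: hits_def)
    \<comment> \<open>As \<open>2 * L \<le> K\<close>, half of the left-hand side absorbs the
      movement of \<open>f\<close>.\<close>
    also have "L * dist x y \<le> K / 2 * dist x y" using K by (intro mult_right_mono) auto
    finally show ?thesis using K by (simp add: field_simps)
  qed
  obtain P where P: "finite P" "P \<subseteq> J \<inter> hits m" "\<And>p q. p \<in> P \<Longrightarrow> q \<in> P \<Longrightarrow> p \<noteq> q \<Longrightarrow> s \<le> dist p q"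
    "J \<inter> hits m \<subseteq> (\<Union>p\<in>P. ball p s)" using separated_net[OF compact_UNIV \<open>0 < s\<close>, of "J \<inter> hits m"] by metis
  define N where "N = real (card P)"
  have "N * (\<eta>\<^sub>1 * (s/2) powr \<delta>) \<le> prob (ball y\<^sub>1 (5 * (\<psi> m / K)))"
    unfolding N_def
  proof (rule packing[OF P(1)])
    show "(\<Union>p\<in>P. ball p (s/2)) \<subseteq> ball y\<^sub>1 (5 * (\<psi> m / K))"
    proof clarify
      fix p x assume "p \<in> P" "x \<in> ball p (s/2)"
      then have "dist y\<^sub>1 p \<le> 4 * (\<psi> m / K)" "dist p x < \<psi> m / K" using diam y1 P(2) s by auto
      then show "x \<in> ball y\<^sub>1 (5 * (\<psi> m / K))" using dist_triangle[of y\<^sub>1 x p] by simp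
    qed
  qed (use P(3) s mK small in auto)
  also have "\<dots> \<le> \<eta>\<^sub>2 * (5 * (\<psi> m / K)) powr \<delta>"
    by (rule ball_upper) (use \<psi> K mK small in auto)
  also have "\<dots> = \<eta>\<^sub>2 * 10 powr \<delta> * (\<psi> m / K / s) powr \<delta> * (s/2) powr \<delta>"
  proof -
    have "5 * (\<psi> m / K) = 10 * (\<psi> m / K / s) * (s/2)" using s K by simp
    then show ?thesis using s K \<psi> by (simp only: powr_mult) 
  qed
  finally have "N * \<eta>\<^sub>1 \<le> \<eta>\<^sub>2 * 10 powr \<delta> * (\<psi> m / K / s) powr \<delta>"
    using s by (simp add: mult.assoc[symmetric])
  define c\<^sub>3 where "c\<^sub>3 = \<eta>\<^sub>2 / \<eta>\<^sub>1 * 10 powr \<delta>"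
  have c3: "0 \<le> c\<^sub>3" using pos by (simp add: c\<^sub>3_def)
  have N: "N \<le> c\<^sub>3 * (\<psi> m / K / s) powr \<delta>"
    using \<open>N * \<eta>\<^sub>1 \<le> _\<close> pos by (simp add: c\<^sub>3_def field_simps)
  \<comment> \<open>\<open>N1\<close> serves the product of the two ball measures in the mixing
    bound, \<open>N2\<close> the error term with \<open>a (n - m)\<close>.\<close>
  have N1: "N * (K * s) powr \<delta> \<le> c\<^sub>3 * ?p"
  proof -
    have "N * (K * s) powr \<delta> \<le> c\<^sub>3 * (\<psi> m / K / s) powr \<delta> * (K * s) powr \<delta>"
      using N by (intro mult_right_mono) auto
    also have "\<dots> = c\<^sub>3 * (\<psi> m / K / s * (K * s)) powr \<delta>" by (simp only: powr_mult mult.assoc)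
    also have "\<psi> m / K / s * (K * s) = \<psi> m" using s K by simp
    finally show ?thesis .
  qed
  have N2: "N * ?q \<le> c\<^sub>3 * (?p + ?q)"
  proof -
    have "N * ?q \<le> c\<^sub>3 * (\<psi> m / K / s) powr \<delta> * ?q" using N by (intro mult_right_mono) auto
    also have "\<dots> = c\<^sub>3 * (\<psi> m / K / s * \<psi> n) powr \<delta>" by (simp only: powr_mult mult.assoc)
    also have "(\<psi> m / K / s * \<psi> n) powr \<delta> \<le> ?p + ?q"
    \<comment> \<open>Either \<open>s\<close> is \<open>\<psi> m / K\<close> and the quotient is 1,
      or \<open>s\<close> is \<open>\<psi> n\<close> and cancels.\<close>
    proof (cases "\<psi> m / K \<le> \<psi> n")
      case True
      then have "\<psi> m / K / s = 1" using \<psi> K by (simp add: s_def)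
      then show ?thesis by simp
    next
      case False
      then have "\<psi> m / K / s * \<psi> n = \<psi> m / K" using \<psi> by (simp add: s_def)
      then have "(\<psi> m / K / s * \<psi> n) powr \<delta> \<le> ?p" using mK \<psi> K pos by (simp add: powr_mono2)
      then show ?thesis by (smt (verit) powr_ge_zero)
    qed
    finally show ?thesis using c3 by (simp add: mult_left_mono)
  qed
  \<comment> \<open>The condition that a double hit near \<open>p\<close> imposes on the point
    reached at time \<open>m\<close>.\<close>
  define A where "A p = ball ((T ^^ m) p) (Q * K * s) \<inter> (T ^^ (n - m)) -` ball (f p) ((1 + L) * \<psi> n)" for p
  have A: "A p \<in> events" for p unfolding A_def using vimage_iterate by auto
  define H where "H = \<eta>\<^sub>2 / \<eta>\<^sub>1 * (2 / K) powr \<delta>"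
  have H: "0 \<le> H" using pos by (simp add: H_def)
  have QKs: "Q * K * s \<le> Q * \<psi> m" using Ks Q by (simp add: mult_left_mono mult.assoc)
  then have QKr: "Q * K * s < r\<^sub>0" using small(1) by linarith
  have piece: "prob (J \<inter> (T ^^ m) -` A p) \<le> H * ((\<eta>\<^sub>2 * (Q * K * s) powr \<delta> + ?a) * (\<eta>\<^sub>2 * ((1 + L) * \<psi> n) powr \<delta>))" for p
  proof -
    have "prob (J \<inter> (T ^^ m) -` A p) \<le> H * prob (A p)" unfolding H_def
      by (rule expanding_preimage[OF J iterate_measurable cont exp]) (use K A in auto)
    also have "prob (A p) \<le> (prob (ball ((T ^^ m) p) (Q * K * s)) + ?a) * prob (ball (f p) ((1 + L) * \<psi> n))"
      unfolding A_def by (rule mixing_upper) (use mn s K Q \<psi> L_nonneg in auto)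
    also have "\<dots> \<le> (\<eta>\<^sub>2 * (Q * K * s) powr \<delta> + ?a) * (\<eta>\<^sub>2 * ((1 + L) * \<psi> n) powr \<delta>)"
      by (intro mult_mono add_mono ball_upper)
         (use small QKr s K Q \<psi> L_nonneg a_nonneg pos in auto)
    finally show ?thesis using H by (simp add: mult_left_mono)
  qed
  have "J \<inter> (hits m \<inter> hits n) \<subseteq> (\<Union>p\<in>P. J \<inter> (T ^^ m) -` A p)"
  proof
    fix x assume x: "x \<in> J \<inter> (hits m \<inter> hits n)"
    then obtain p where p: "p \<in> P" "dist p x < s" using P(4) by (auto simp: subset_iff)
    have "dist ((T ^^ m) p) ((T ^^ m) x) \<le> Q * K * dist p x" using lip p P(2) x by auto
    also have "\<dots> < Q * K * s" using p Q K by simp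
    finally have 1: "(T ^^ m) x \<in> ball ((T ^^ m) p) (Q * K * s)" by simp
    have "(T ^^ (n - m)) ((T ^^ m) x) = (T ^^ n) x"
      using mn by (simp flip: funpow_add comp_apply[of "T ^^ (n - m)" "T ^^ m"])
    moreover have "dist (f p) ((T ^^ n) x) < (1 + L) * \<psi> n"
    proof -
      have "dist (f p) ((T ^^ n) x) \<le> dist (f p) (f x) + dist ((T ^^ n) x) (f x)"
        by (metis dist_commute dist_triangle)
      also have "dist (f p) (f x) \<le> L * dist p x" by (rule f_dist)
      also have "\<dots> \<le> L * \<psi> n" using p s L_nonneg by (intro mult_left_mono) auto
      also have "dist ((T ^^ n) x) (f x) < \<psi> n" using x by (simp add: hits_def)
      finally show ?thesis by (simp add: algebra_simps)
    qed
    ultimately show "x \<in> (\<Union>p\<in>P. J \<inter> (T ^^ m) -` A p)" using 1 p x by (auto simp: A_def)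
  qed
  then have "prob (J \<inter> (hits m \<inter> hits n)) \<le> prob (\<Union>p\<in>P. J \<inter> (T ^^ m) -` A p)"
    using P(1) J A vimage_iterate by (intro finite_measure_mono sets.finite_UN) auto
  also have "\<dots> \<le> (\<Sum>p\<in>P. prob (J \<inter> (T ^^ m) -` A p))"
    by (rule finite_measure_subadditive_finite) (use P(1) J A vimage_iterate in auto)
  also have "\<dots> \<le> (\<Sum>p\<in>P. H * ((\<eta>\<^sub>2 * (Q * K * s) powr \<delta> + ?a) * (\<eta>\<^sub>2 * ((1 + L) * \<psi> n) powr \<delta>)))"
    by (intro sum_mono piece)
  also have "\<dots> = H * \<eta>\<^sub>2 * (1 + L) powr \<delta> * (\<eta>\<^sub>2 * Q powr \<delta> * (N * (K * s) powr \<delta>) * ?q + ?a * (N * ?q))"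
  proof -
    have "(Q * K * s) powr \<delta> = Q powr \<delta> * (K * s) powr \<delta>"
      "((1 + L) * \<psi> n) powr \<delta> = (1 + L) powr \<delta> * ?q" by (simp_all only: powr_mult mult.assoc)
    then show ?thesis by (simp only: N_def sum_constant) (simp add: distrib_left distrib_right mult_ac)
  qed
  also have "\<dots> \<le> H * \<eta>\<^sub>2 * (1 + L) powr \<delta> * (\<eta>\<^sub>2 * Q powr \<delta> * (c\<^sub>3 * ?p) * ?q + ?a * (c\<^sub>3 * (?p + ?q)))"
    using H pos N1 N2 a_nonneg
    by (intro mult_left_mono add_mono mult_right_mono mult_nonneg_nonneg) auto
  also have "\<dots> = H * \<eta>\<^sub>2 * (1 + L) powr \<delta> * c\<^sub>3 * (\<eta>\<^sub>2 * Q powr \<delta> * (?p * ?q) + 1 * (?a * (?p + ?q)))"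
    by (simp add: algebra_simps)
  \<comment> \<open>Both coefficients are raised to their sum, so that the two terms share one
    constant.\<close>
  also have "\<dots> \<le> H * \<eta>\<^sub>2 * (1 + L) powr \<delta> * c\<^sub>3 * ((\<eta>\<^sub>2 * Q powr \<delta> + 1) * (?p * ?q) + (\<eta>\<^sub>2 * Q powr \<delta> + 1) * (?a * (?p + ?q)))"
    using H pos c3 a_nonneg
    by (intro mult_left_mono add_mono mult_right_mono mult_nonneg_nonneg) auto
  also have "\<dots> = ?D * K powr (- \<delta>) * (?p * ?q + ?a * (?p + ?q))"
  proof -
    have "H = \<eta>\<^sub>2 / \<eta>\<^sub>1 * 2 powr \<delta> * K powr (- \<delta>)"
      using K by (simp add: H_def powr_divide powr_minus_divide)
    then show ?thesis
      by (simp only: distrib_left[symmetric] c\<^sub>3_def power2_eq_square) (simp add: mult_ac)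
  qed
  finally show ?thesis .
qed

end

text \<open>An abstraction of the cylinders of order \<open>m\<close>. \<open>\<kappa>\<close> is
  arbitrary and the threshold for \<open>m\<close> may depend on it, which encodes unbounded
  expansion, while \<open>Q\<close> and \<open>\<tau>\<close> are uniform.\<close>

locale branched_recurrence = twisted_recurrence M \<delta> \<eta>\<^sub>1 \<eta>\<^sub>2 r\<^sub>0 T f a \<psi> L
  for M :: "'a::{metric_space, second_countable_topology} measure" and \<delta> \<eta>\<^sub>1 \<eta>\<^sub>2 r\<^sub>0 T f a \<psi> L +
  fixes Q \<tau> :: real
  assumes Q: "1 \<le> Q" and \<tau>: "0 < \<tau>"
    and branches: "\<forall>\<^sub>F m in sequentially. \<exists>\<F>. countable \<F> \<and> disjoint \<F> \<and> \<F> \<subseteq> events \<and> prob (\<Union>\<F>) = 1 \<and>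
      (\<forall>J\<in>\<F>. continuous_on J (T ^^ m) \<and> (T ^^ m) ` J \<in> events \<and> \<tau> \<le> prob ((T ^^ m) ` J) \<and>
        (\<exists>K\<ge>\<kappa>. \<forall>x\<in>J. \<forall>y\<in>J. K * dist x y \<le> dist ((T ^^ m) x) ((T ^^ m) y) \<and>
          dist ((T ^^ m) x) ((T ^^ m) y) \<le> Q * K * dist x y))"
begin

text \<open>For large \<open>m\<close>, cells meeting the ball are so small that they lie in the
  doubled ball. Each contributes a multiple of \<open>K powr (- \<delta>)\<close>, which is at most
  a multiple of \<open>prob J\<close> since the image of \<open>J\<close> is large; summing over
  disjoint cells costs only the measure of the doubled ball.\<close>

lemma hits_ball_pair_upper:
  obtains C where "0 < C"
    "\<And>z R. 0 < R \<Longrightarrow> 2 * R < r\<^sub>0 \<Longrightarrow> \<forall>\<^sub>F m in sequentially. \<forall>n>m.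
       prob (ball z R \<inter> (hits m \<inter> hits n)) \<le>
         C * prob (ball z R) * (\<psi> m powr \<delta> * \<psi> n powr \<delta> + a (n - m) * (\<psi> m powr \<delta> + \<psi> n powr \<delta>))"
proof -
  define D where "D = (\<eta>\<^sub>2 / \<eta>\<^sub>1)\<^sup>2 * 2 powr \<delta> * 10 powr \<delta> * \<eta>\<^sub>2 * (1 + L) powr \<delta> * (\<eta>\<^sub>2 * Q powr \<delta> + 1)"
  define D' where "D' = D * (\<eta>\<^sub>2 / \<eta>\<^sub>1 * (2 * Q) powr \<delta> / \<tau>)"
  define C where "C = D' * (\<eta>\<^sub>2 / \<eta>\<^sub>1 * 2 powr \<delta>)"
  have D: "0 < D" using pos L_nonneg by (auto simp: D_def intro!: mult_pos_pos add_nonneg_pos)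
  have D': "0 < D'" using pos Q \<tau> D by (simp add: D'_def)
  show thesis
  proof (rule that[of C])
    show "0 < C" using pos D' by (simp add: C_def)
    fix z R assume R: "0 < R" "2 * R < r\<^sub>0"
    obtain W where W: "\<And>x y :: 'a. dist x y \<le> W"
      using compact_imp_bounded[OF compact_UNIV] bounded_two_points[of "UNIV :: 'a set"] by auto
    \<comment> \<open>The inner maximum is what \<open>hits_pair_upper\<close> requires; the last
      entry shrinks cells to diameter at most \<open>R\<close>, as \<open>W\<close> bounds all
      distances.\<close>
    define \<kappa> where "\<kappa> = max (max 1 (2 * L)) ((W + 1) / R)"
    \<comment> \<open>Once \<open>\<psi>\<close> is below \<open>e\<close>, its multiples by
      \<open>Q\<close>, 5 and \<open>1 + L\<close> are below \<open>r\<^sub>0\<close>.\<close>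
    define e where "e = r\<^sub>0 / (Q + 5 + L)"
    have e: "0 < e" using pos Q L_nonneg by (simp add: e_def)
    have small: "q * t < r\<^sub>0" if "t < e" "0 < t" "q \<le> Q + 5 + L" for q t
    proof -
      have "q * t \<le> (Q + 5 + L) * t" using that by (intro mult_right_mono) auto
      also have "\<dots> < (Q + 5 + L) * e" using that Q L_nonneg by (intro mult_strict_left_mono) auto
      also have "\<dots> = r\<^sub>0" using Q L_nonneg by (simp add: e_def)
      finally show ?thesis .
    qed
    have "\<forall>\<^sub>F m in sequentially. \<forall>n\<ge>m. \<psi> n < e"
      using \<psi>_eventually_small[OF e] by (rule eventually_all_ge_at_top)
    moreover have "\<forall>\<^sub>F m in sequentially. (1::nat) \<le> m" by (rule eventually_ge_at_top)
    ultimately show "\<forall>\<^sub>F m in sequentially. \<forall>n>m.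
       prob (ball z R \<inter> (hits m \<inter> hits n)) \<le>
         C * prob (ball z R) * (\<psi> m powr \<delta> * \<psi> n powr \<delta> + a (n - m) * (\<psi> m powr \<delta> + \<psi> n powr \<delta>))"
      using branches[of \<kappa>]
    proof eventually_elim
      case (elim m)
      from elim(3) obtain \<F> where \<F>: "countable \<F>" "disjoint \<F>" "\<F> \<subseteq> events" "prob (\<Union>\<F>) = 1"
        and br: "\<And>J. J \<in> \<F> \<Longrightarrow> continuous_on J (T ^^ m)" "\<And>J. J \<in> \<F> \<Longrightarrow> (T ^^ m) ` J \<in> events"
          "\<And>J. J \<in> \<F> \<Longrightarrow> \<tau> \<le> prob ((T ^^ m) ` J)"
          "\<And>J. J \<in> \<F> \<Longrightarrow> \<exists>K\<ge>\<kappa>. \<forall>x\<in>J. \<forall>y\<in>J. K * dist x y \<le> dist ((T ^^ m) x) ((T ^^ m) y) \<and>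
          dist ((T ^^ m) x) ((T ^^ m) y) \<le> Q * K * dist x y" by blast
      show ?case
      proof (intro allI impI)
        fix n assume "m < n"
        define X where "X = \<psi> m powr \<delta> * \<psi> n powr \<delta> + a (n - m) * (\<psi> m powr \<delta> + \<psi> n powr \<delta>)"
        have X: "0 \<le> X" using a_nonneg by (simp add: X_def)
        have \<psi>: "0 < \<psi> m" "0 < \<psi> n" "\<psi> m < e" "\<psi> n < e" using elim \<psi>_pos \<open>m < n\<close> by auto
        have "prob (ball z R \<inter> (hits m \<inter> hits n)) \<le> D' * X * prob (ball z (2 * R))"
        proof (rule prob_le_via_partition[OF \<F>])
          fix J assume J: "J \<in> \<F>"
          obtain K where K: "\<kappa> \<le> K" and exp: "\<And>x y. x \<in> J \<Longrightarrow> y \<in> J \<Longrightarrow> K * dist x y \<le> dist ((T ^^ m) x) ((T ^^ m) y)"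
            and lip: "\<And>x y. x \<in> J \<Longrightarrow> y \<in> J \<Longrightarrow> dist ((T ^^ m) x) ((T ^^ m) y) \<le> Q * K * dist x y"
            using br(4)[OF J] by blast
          have K1: "1 \<le> K" "2 * L \<le> K" "(W + 1) / R \<le> K" using K by (auto simp: \<kappa>_def)
          have mJ: "J \<in> events" using J \<F> by auto
          show "prob (ball z R \<inter> (hits m \<inter> hits n) \<inter> J) \<le> D' * X * prob (J \<inter> ball z (2 * R))"
          proof (cases "J \<inter> ball z R = {}")
            case True
            then have "ball z R \<inter> (hits m \<inter> hits n) \<inter> J = {}" by auto
            then show ?thesis using D' X by simp
          next
            case False
            then obtain x where x: "x \<in> J" "dist z x < R" by auto
            have "J \<subseteq> ball z (2 * R)"
            proof
              fix y assume "y \<in> J"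
              have "(W + 1) / R * dist x y \<le> K * dist x y" using K1 by (intro mult_right_mono) auto
              also have "\<dots> \<le> W" using exp[OF x(1) \<open>y \<in> J\<close>] W order_trans by blast
              finally have "(W + 1) * dist x y \<le> W * R" using R by (simp add: field_simps)
              also have "\<dots> \<le> (W + 1) * R" using R by simp
              finally have "dist x y \<le> R" using W[of x x] by simp
              then show "y \<in> ball z (2 * R)" using x(2) dist_triangle[of z y x] by simp
            qed
            then have JJ: "J \<inter> ball z (2 * R) = J" by auto
            \<comment> \<open>\<open>T ^^ m\<close> stretches \<open>J\<close> by at most
              \<open>Q * K\<close> onto a set of measure at least \<open>\<tau>\<close>, so
              \<open>prob J\<close> is at least of order \<open>K powr (- \<delta>)\<close>.\<close>
            have "\<tau> \<le> prob ((T ^^ m) ` J)" by (rule br(3)[OF J])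
            also have "\<dots> \<le> \<eta>\<^sub>2 / \<eta>\<^sub>1 * (2 * (Q * K)) powr \<delta> * prob J"
              by (rule bilipschitz_image[OF mJ br(2)[OF J] exp _ lip]) (use K1 Q in auto)
            also have "\<dots> = \<eta>\<^sub>2 / \<eta>\<^sub>1 * (2 * Q) powr \<delta> * K powr \<delta> * prob J" by (simp add: powr_mult)
            finally have "K powr (- \<delta>) * \<tau> \<le> K powr (- \<delta>) * (\<eta>\<^sub>2 / \<eta>\<^sub>1 * (2 * Q) powr \<delta> * K powr \<delta> * prob J)"
              by (intro mult_left_mono) auto
            also have "\<dots> = \<eta>\<^sub>2 / \<eta>\<^sub>1 * (2 * Q) powr \<delta> * prob J"
              using K1 by (simp add: powr_minus field_simps)
            finally have "K powr (- \<delta>) \<le> \<eta>\<^sub>2 / \<eta>\<^sub>1 * (2 * Q) powr \<delta> / \<tau> * prob J"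
              using \<tau> pos by (simp add: field_simps)
            then have KJ: "D * K powr (- \<delta>) * X \<le> D * (\<eta>\<^sub>2 / \<eta>\<^sub>1 * (2 * Q) powr \<delta> / \<tau> * prob J) * X"
              using D X by (intro mult_right_mono mult_left_mono) auto
            have "prob (ball z R \<inter> (hits m \<inter> hits n) \<inter> J) \<le> prob (J \<inter> (hits m \<inter> hits n))"
              using mJ by (intro finite_measure_mono) auto
            also have "\<dots> \<le> D * K powr (- \<delta>) * X"
              unfolding D_def X_def
              by (rule hits_pair_upper[OF mJ br(1)[OF J] elim(2) \<open>m < n\<close> K1(1,2) Q exp lip])
                 (use small \<psi> Q L_nonneg in auto)
            also note KJ
            also have "D * (\<eta>\<^sub>2 / \<eta>\<^sub>1 * (2 * Q) powr \<delta> / \<tau> * prob J) * X = D' * X * prob J"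
              by (simp add: D'_def)
            finally show ?thesis by (simp add: JJ)
          qed
        qed (use D' X in auto)
        \<comment> \<open>Ahlfors regularity is doubling, which returns from \<open>2 * R\<close> to
          \<open>R\<close>.\<close>
        also have "\<dots> \<le> D' * X * (\<eta>\<^sub>2 / \<eta>\<^sub>1 * 2 powr \<delta> * prob (ball z R))"
        proof (intro mult_left_mono)
          have "prob (ball z (2 * R)) \<le> \<eta>\<^sub>2 * (2 * R) powr \<delta>" using R by (intro ball_upper) auto
          also have "\<dots> = \<eta>\<^sub>2 / \<eta>\<^sub>1 * 2 powr \<delta> * (\<eta>\<^sub>1 * R powr \<delta>)" using pos by (simp add: powr_mult)
          also have "\<dots> \<le> \<eta>\<^sub>2 / \<eta>\<^sub>1 * 2 powr \<delta> * prob (ball z R)"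
            using R pos by (intro mult_left_mono ball_lower) auto
          finally show "prob (ball z (2 * R)) \<le> \<eta>\<^sub>2 / \<eta>\<^sub>1 * 2 powr \<delta> * prob (ball z R)" .
        qed (use D' X in auto)
        finally show "prob (ball z R \<inter> (hits m \<inter> hits n)) \<le> C * prob (ball z R) *
          (\<psi> m powr \<delta> * \<psi> n powr \<delta> + a (n - m) * (\<psi> m powr \<delta> + \<psi> n powr \<delta>))"
          by (simp add: C_def X_def mult_ac)
      qed
    qed
  qed
qed

end

section \<open>Second moment of the number of hits in a ball\<close>

text \<open>On either side of \<open>m\<close> the differences are pairwise distinct, so every term
  of \<open>a\<close> occurs at most twice.\<close>

lemma sum_shift_le:
  fixes a :: "nat \<Rightarrow> real"
  assumes "\<And>n. 0 \<le> a n" "summable a" "finite F"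
  shows "(\<Sum>n\<in>F. a (if m < n then n - m else m - n)) \<le> 2 * suminf a"
proof -
  let ?d = "\<lambda>n. if m < n then n - m else m - n"
  have "(\<Sum>n\<in>F. a (?d n)) = (\<Sum>n\<in>F \<inter> {n. m < n}. a (n - m)) + (\<Sum>n\<in>F \<inter> - {n. m < n}. a (m - n))"
    using sum.If_cases[of F "\<lambda>n. m < n" "\<lambda>n. a (n - m)" "\<lambda>n. a (m - n)"] \<open>finite F\<close>
    by (simp add: if_distrib[of a] cong: if_cong)
  also have "(\<Sum>n\<in>F \<inter> {n. m < n}. a (n - m)) = sum a ((\<lambda>n. n - m) ` (F \<inter> {n. m < n}))"
    by (subst sum.reindex) (auto simp: inj_on_def)
  also have "\<dots> \<le> suminf a" using assms by (intro sum_le_suminf) auto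
  also have "(\<Sum>n\<in>F \<inter> - {n. m < n}. a (m - n)) = sum a ((\<lambda>n. m - n) ` (F \<inter> - {n. m < n}))"
    by (subst sum.reindex) (auto simp: inj_on_def)
  also have "\<dots> \<le> suminf a" using assms by (intro sum_le_suminf) auto
  finally show ?thesis by simp
qed

context branched_recurrence
begin

text \<open>The second moment inequality on a window of times from \<open>k\<close> on, long enough
  for the sum \<open>S\<close> of \<open>\<psi> n powr \<delta>\<close> to be large. The first
  moment is at least of order \<open>b * S\<close>. The sum over distinct pairs is at most of order
  \<open>b * S\<^sup>2\<close>, because summability of \<open>a\<close> makes the mixing errors
  linear in \<open>S\<close>. The quotient is \<open>b\<close> times a constant independent of
  \<open>k\<close> and of the ball.\<close>

lemma hits_ball_union_lower:
  obtains c where "0 < c"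
    "\<And>z R. 0 < R \<Longrightarrow> 2 * R < r\<^sub>0 \<Longrightarrow>
      \<forall>\<^sub>F k in sequentially. c * prob (ball z R) \<le> prob (ball z R \<inter> (\<Union>n\<in>{k..}. hits n))"
proof -
  obtain c C\<^sub>0 where c: "0 < c" "0 \<le> C\<^sub>0"
    and lower: "\<And>x R. 0 < R \<Longrightarrow> R < r\<^sub>0 \<Longrightarrow> \<forall>\<^sub>F n in sequentially.
       c * prob (ball x R) * \<psi> n powr \<delta> - C\<^sub>0 * a n \<le> prob (ball x R \<inter> hits n)"
    using hits_ball_lower by blast
  obtain C where C: "0 < C" and upper: "\<And>z R. 0 < R \<Longrightarrow> 2 * R < r\<^sub>0 \<Longrightarrow> \<forall>\<^sub>F m in sequentially. \<forall>n>m.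
       prob (ball z R \<inter> (hits m \<inter> hits n)) \<le>
         C * prob (ball z R) * (\<psi> m powr \<delta> * \<psi> n powr \<delta> + a (n - m) * (\<psi> m powr \<delta> + \<psi> n powr \<delta>))"
    using hits_ball_pair_upper by blast
  define p where "p n = \<psi> n powr \<delta>" for n
  have p: "0 \<le> p n" for n by (simp add: p_def)
  define A where "A = suminf a"
  have A: "0 \<le> A" unfolding A_def using a_summable a_nonneg by (rule suminf_nonneg)
  show thesis
  proof (rule that[of "c\<^sup>2 / (16 * C)"])
    show "0 < c\<^sup>2 / (16 * C)" using c C by simp
    fix z :: 'a and R assume R: "0 < R" "2 * R < r\<^sub>0"
    define B where "B = ball z R"
    define b where "b = prob B"
    have B: "B \<in> events" by (simp add: B_def)
    have b: "0 < b"
    proof -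
      have "0 < \<eta>\<^sub>1 * R powr \<delta>" using pos R by simp
      also have "\<dots> \<le> b" unfolding b_def B_def using R by (intro ball_lower) auto
      finally show ?thesis .
    qed
    obtain n\<^sub>0 where n0: "\<And>n. n\<^sub>0 \<le> n \<Longrightarrow> c * b * p n - C\<^sub>0 * a n \<le> prob (B \<inter> hits n)"
      "\<And>m n. n\<^sub>0 \<le> m \<Longrightarrow> m < n \<Longrightarrow> prob (B \<inter> (hits m \<inter> hits n)) \<le> C * b * (p m * p n + a (n - m) * (p m + p n))"
    proof -
      have "\<forall>\<^sub>F n in sequentially. (c * b * p n - C\<^sub>0 * a n \<le> prob (B \<inter> hits n)) \<and>
        (\<forall>n'>n. prob (B \<inter> (hits n \<inter> hits n')) \<le> C * b * (p n * p n' + a (n' - n) * (p n + p n')))"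
        unfolding B_def b_def p_def using R by (intro eventually_conj lower upper) auto
      then show ?thesis using that unfolding eventually_sequentially by blast
    qed
    have "c\<^sup>2 / (16 * C) * b \<le> prob (B \<inter> (\<Union>n\<in>{k..}. hits n))" if k: "n\<^sub>0 \<le> k" for k
    proof -
      \<comment> \<open>The summands in turn let \<open>S\<close> absorb the error in the first
        moment, let \<open>S\<^sup>2\<close> absorb the mixing errors of pairs, let the square of
        \<open>P\<close> absorb the diagonal, and ensure positivity.\<close>
      define S\<^sub>0 where "S\<^sub>0 = 2 * C\<^sub>0 * A / (c * b) + 4 * A + c / (4 * C) + 1"
      have "\<not> summable p" using \<psi>_div unfolding p_def .
      then have "\<not> summable (\<lambda>n. p (n + k))" using summable_iff_shift[of p k] by blast
      then obtain N where N: "S\<^sub>0 < (\<Sum>i<N. p (i + k))"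
        using summableI_nonneg_bounded[of "\<lambda>n. p (n + k)" S\<^sub>0] p by (meson not_less)
      define F where "F = (\<lambda>i. i + k) ` {..<N}"
      have F: "finite F" "\<And>n. n \<in> F \<Longrightarrow> k \<le> n" by (auto simp: F_def)
      define S where "S = sum p F"
      have S: "S\<^sub>0 \<le> S" using N by (simp add: S_def F_def sum.reindex)
      have S\<^sub>0: "2 * C\<^sub>0 * A / (c * b) \<le> S\<^sub>0" "4 * A \<le> S\<^sub>0" "c / (4 * C) \<le> S\<^sub>0" "0 < S\<^sub>0"
        using c C b A by (auto simp: S\<^sub>0_def intro!: add_nonneg_pos add_nonneg_nonneg)
      define P where "P = (\<Sum>n\<in>F. prob (B \<inter> hits n))"
      define u where "u = prob (\<Union>n\<in>F. B \<inter> hits n)"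
      have P: "c * b * S / 2 \<le> P"
      proof -
        have "c * b * S - C\<^sub>0 * sum a F = (\<Sum>n\<in>F. c * b * p n - C\<^sub>0 * a n)"
          by (simp add: S_def sum_subtractf sum_distrib_left)
        also have "\<dots> \<le> P" unfolding P_def using F k by (intro sum_mono n0) force
        finally have 1: "c * b * S - C\<^sub>0 * sum a F \<le> P" .
        have "C\<^sub>0 * sum a F \<le> C\<^sub>0 * A"
          unfolding A_def using c F a_nonneg a_summable by (intro mult_left_mono sum_le_suminf) auto
        also have "\<dots> \<le> c * b * S / 2"
        proof -
          have "2 * C\<^sub>0 * A / (c * b) \<le> S" using S S\<^sub>0 by simp
          then show ?thesis using c b by (simp add: field_simps)
        qed
        finally show ?thesis using 1 by simp
      qed
      \<comment> \<open>The distance between the two times, in the form used by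
        \<open>sum_shift_le\<close>.\<close>
      define d where "d m n = (if m < n then n - m else m - n)" for m n :: nat
      have d_commute: "d m n = d n m" for m n by (simp add: d_def)
      have "P\<^sup>2 \<le> u * (\<Sum>m\<in>F. \<Sum>n\<in>F. prob ((B \<inter> hits m) \<inter> (B \<inter> hits n)))"
        unfolding P_def u_def using B F by (intro sum_prob_sq_le) auto
      \<comment> \<open>The mixing error is split in two so that in each half \<open>a\<close> can
        be summed first, with the index of \<open>p\<close> held fixed.\<close>
      also have "\<dots> \<le> u * (\<Sum>m\<in>F. \<Sum>n\<in>F. (if m = n then prob (B \<inter> hits m) else 0) +
          C * b * (p m * p n + a (d m n) * p m + a (d n m) * p n))"
      proof (intro mult_left_mono sum_mono)
        fix m n assume mn: "m \<in> F" "n \<in> F"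
        have eq: "(B \<inter> hits m) \<inter> (B \<inter> hits n) = B \<inter> (hits m \<inter> hits n)" by auto
        have nonneg: "0 \<le> C * b * (p m * p n + a (d m n) * p m + a (d n m) * p n)"
          using C b p a_nonneg by (intro mult_nonneg_nonneg add_nonneg_nonneg) auto
        consider "m = n" | "m < n" | "n < m" by linarith
        then show "prob ((B \<inter> hits m) \<inter> (B \<inter> hits n)) \<le> (if m = n then prob (B \<inter> hits m) else 0) +
          C * b * (p m * p n + a (d m n) * p m + a (d n m) * p n)"
        proof cases
          case 1
          then show ?thesis using nonneg by simp
        next
          case 2
          have "prob (B \<inter> (hits m \<inter> hits n)) \<le> C * b * (p m * p n + a (n - m) * (p m + p n))"
            using F(2)[OF mn(1)] k 2 by (intro n0) auto
          then show ?thesis using 2 by (simp add: eq d_def algebra_simps)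
        next
          case 3
          have "prob (B \<inter> (hits n \<inter> hits m)) \<le> C * b * (p n * p m + a (m - n) * (p n + p m))"
            using F(2)[OF mn(2)] k 3 by (intro n0) auto
          then show ?thesis using 3 by (simp add: eq d_def Int_commute algebra_simps)
        qed
      qed (simp add: u_def)
      also have "(\<Sum>m\<in>F. \<Sum>n\<in>F. (if m = n then prob (B \<inter> hits m) else 0) +
          C * b * (p m * p n + a (d m n) * p m + a (d n m) * p n))
        = P + C * b * (S\<^sup>2 + (\<Sum>m\<in>F. \<Sum>n\<in>F. a (d m n) * p m) + (\<Sum>m\<in>F. \<Sum>n\<in>F. a (d n m) * p n))"
        using F(1) by (simp add: sum.distrib P_def S_def power2_eq_square sum_product flip: sum_distrib_left)
      also have "(\<Sum>m\<in>F. \<Sum>n\<in>F. a (d n m) * p n) = (\<Sum>m\<in>F. \<Sum>n\<in>F. a (d m n) * p m)"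
        by (rule sum.swap)
      also have "u * (P + C * b * (S\<^sup>2 + (\<Sum>m\<in>F. \<Sum>n\<in>F. a (d m n) * p m) + (\<Sum>m\<in>F. \<Sum>n\<in>F. a (d m n) * p m)))
        \<le> u * (P + C * b * (S\<^sup>2 + 2 * A * S + 2 * A * S))"
      proof -
        have "(\<Sum>m\<in>F. \<Sum>n\<in>F. a (d m n) * p m) = (\<Sum>m\<in>F. (\<Sum>n\<in>F. a (d m n)) * p m)"
          by (simp add: sum_distrib_right)
        also have "\<dots> \<le> (\<Sum>m\<in>F. 2 * A * p m)"
          unfolding A_def d_def using a_nonneg a_summable F(1) p
          by (intro sum_mono mult_right_mono sum_shift_le) auto
        finally have "(\<Sum>m\<in>F. \<Sum>n\<in>F. a (d m n) * p m) \<le> 2 * A * S" by (simp add: S_def sum_distrib_left)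
        then show ?thesis using C b by (intro mult_left_mono add_mono order_refl) (auto simp: u_def)
      qed
      also have "\<dots> \<le> u * (P + 2 * C * b * S\<^sup>2)"
      proof -
        have "4 * A * S \<le> S * S" using S S\<^sub>0 by (intro mult_right_mono) auto
        then have "C * b * (S\<^sup>2 + 2 * A * S + 2 * A * S) \<le> C * b * (2 * S\<^sup>2)"
          using C b by (intro mult_left_mono) (auto simp: power2_eq_square)
        then show ?thesis by (intro mult_left_mono add_left_mono) (auto simp: u_def mult_ac)
      qed
      \<comment> \<open>The lower bound for \<open>P\<close> eliminates \<open>S\<close>, so the
        first moment never has to be bounded from above.\<close>
      also have "\<dots> \<le> u * (P + 8 * C / (c\<^sup>2 * b) * P\<^sup>2)"
      proof -
        have "(c * b * S / 2)\<^sup>2 \<le> P\<^sup>2" using P c b S S\<^sub>0 by (intro power_mono) auto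
        then have "2 * C * b * S\<^sup>2 \<le> 8 * C / (c\<^sup>2 * b) * P\<^sup>2"
          using c b C by (simp add: field_simps power2_eq_square)
        then show ?thesis by (intro mult_left_mono add_left_mono) (auto simp: u_def)
      qed
      finally have main: "P\<^sup>2 \<le> u * (P + 8 * C / (c\<^sup>2 * b) * P\<^sup>2)" .
      \<comment> \<open>Beyond this size of \<open>P\<close> the linear diagonal term is dominated
        by the quadratic one.\<close>
      have "c\<^sup>2 * b / (8 * C) \<le> P"
      proof -
        have "c\<^sup>2 * b / (8 * C) = c * b * (c / (4 * C)) / 2" by (simp add: power2_eq_square)
        also have "\<dots> \<le> c * b * S / 2" using S S\<^sub>0 c b by (intro divide_right_mono mult_left_mono) auto
        finally show ?thesis using P by linarith
      qed
      moreover have "0 < c\<^sup>2 * b / (8 * C)" using c b C by simp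
      ultimately have Ppos: "0 < P" "1 \<le> 8 * C / (c\<^sup>2 * b) * P"
        using c b C by (linarith, simp add: field_simps)
      have "P * 1 \<le> P * (8 * C / (c\<^sup>2 * b) * P)" using Ppos by (intro mult_left_mono) auto
      also have "\<dots> = 8 * C / (c\<^sup>2 * b) * P\<^sup>2" by (simp add: power2_eq_square)
      finally have "P \<le> 8 * C / (c\<^sup>2 * b) * P\<^sup>2" by (simp only: mult_1_right)
      then have "u * (P + 8 * C / (c\<^sup>2 * b) * P\<^sup>2) \<le> u * (8 * C / (c\<^sup>2 * b) * P\<^sup>2 + 8 * C / (c\<^sup>2 * b) * P\<^sup>2)"
        by (intro mult_left_mono add_right_mono) (simp_all add: u_def)
      with main have "1 * P\<^sup>2 \<le> u * (16 * C / (c\<^sup>2 * b)) * P\<^sup>2"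
        by (simp add: field_simps)
      then have "1 \<le> u * (16 * C / (c\<^sup>2 * b))"
        using Ppos by (intro mult_right_le_imp_le[of 1 "P\<^sup>2"]) simp_all
      then have "c\<^sup>2 / (16 * C) * b \<le> u" using c b C by (simp add: field_simps)
      also have "u \<le> prob (B \<inter> (\<Union>n\<in>{k..}. hits n))"
        unfolding u_def using F B by (intro finite_measure_mono) auto
      finally show ?thesis .
    qed
    then show "\<forall>\<^sub>F k in sequentially. c\<^sup>2 / (16 * C) * prob (ball z R) \<le> prob (ball z R \<inter> (\<Union>n\<in>{k..}. hits n))"
      unfolding eventually_sequentially B_def b_def by blast
  qed
qed

text \<open>The sets of points with a hit from time \<open>k\<close> on decrease in
  \<open>k\<close>, so the lower bound in a ball passes to their intersection. The threshold for
  \<open>k\<close> depends on the ball but \<open>c\<close> does not, as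
  \<open>prob_eq_1_if_dense\<close> demands.\<close>

theorem prob_hits_infinitely_often: "prob {x. \<exists>\<^sub>\<infinity>n. x \<in> hits n} = 1"
proof -
  obtain c where c: "0 < c" and lower: "\<And>z R. 0 < R \<Longrightarrow> 2 * R < r\<^sub>0 \<Longrightarrow>
      \<forall>\<^sub>F k in sequentially. c * prob (ball z R) \<le> prob (ball z R \<inter> (\<Union>n\<in>{k..}. hits n))"
    using hits_ball_union_lower by blast
  have eq: "{x. \<exists>\<^sub>\<infinity>n. x \<in> hits n} = (\<Inter>k. \<Union>n\<in>{k..}. hits n)"
    by (auto simp: INFM_nat_le)
  show ?thesis unfolding eq
  proof (rule prob_eq_1_if_dense[OF _ c])
    show "0 < r\<^sub>0 / 2" using pos by simp
    fix z :: 'a and R :: real assume "0 < R" "R < r\<^sub>0 / 2"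
    then have ev: "\<forall>\<^sub>F k in sequentially. c * prob (ball z R) \<le> prob (ball z R \<inter> (\<Union>n\<in>{k..}. hits n))"
      by (intro lower) auto
    have "(\<lambda>k. prob (ball z R \<inter> (\<Union>n\<in>{k..}. hits n))) \<longlonglongrightarrow> prob (\<Inter>k. ball z R \<inter> (\<Union>n\<in>{k..}. hits n))"
      by (rule finite_Lim_measure_decseq) (auto simp: decseq_def, fastforce)
    from tendsto_lowerbound[OF this ev]
    show "c * prob (ball z R) \<le> prob (ball z R \<inter> (\<Inter>k. \<Union>n\<in>{k..}. hits n))" by simp
  qed auto
qed

end

section \<open>Cylinders\<close>

lemma cylinders_countable:
  assumes "countable I"
  shows "countable (cylinders T I X m)"
proof -
  have "cylinders T I X m \<subseteq> (\<lambda>w. \<Inter>k<m. (T ^^ k) -` X (w k)) ` ({..<m} \<rightarrow>\<^sub>E I)"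
  proof
    fix J assume "J \<in> cylinders T I X m"
    then obtain w where w: "J = (\<Inter>k<m. (T ^^ k) -` X (w k))" "\<forall>k<m. w k \<in> I"
      by (auto simp: cylinders_def)
    \<comment> \<open>Cutting words to their first \<open>m\<close> letters leaves only countably
      many of them.\<close>
    then have "J = (\<Inter>k<m. (T ^^ k) -` X (restrict w {..<m} k))" by simp
    then show "J \<in> (\<lambda>w. \<Inter>k<m. (T ^^ k) -` X (w k)) ` ({..<m} \<rightarrow>\<^sub>E I)"
      using w(2) by (intro image_eqI[of _ _ "restrict w {..<m}"]) auto
  qed
  moreover have "countable ((\<lambda>w. \<Inter>k<m. (T ^^ k) -` X (w k)) ` ({..<m} \<rightarrow>\<^sub>E I))"
    using assms by (intro countable_image countable_PiE) auto
  ultimately show ?thesis by (rule countable_subset)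
qed

lemma cylinders_disjoint:
  assumes "disjoint_family_on X I"
  shows "disjoint (cylinders T I X m)"
proof (rule disjointI)
  fix J J' assume "J \<in> cylinders T I X m" "J' \<in> cylinders T I X m" "J \<noteq> J'"
  then obtain w w' where w: "J = (\<Inter>k<m. (T ^^ k) -` X (w k))" "\<forall>k<m. w k \<in> I"
    "J' = (\<Inter>k<m. (T ^^ k) -` X (w' k))" "\<forall>k<m. w' k \<in> I" by (auto simp: cylinders_def)
  then obtain k where k: "k < m" "w k \<noteq> w' k" using \<open>J \<noteq> J'\<close> by fastforce
  then have "X (w k) \<inter> X (w' k) = {}" using assms w by (auto simp: disjoint_family_on_def)
  then show "J \<inter> J' = {}" using w k by auto
qed

lemma cylinder_continuous_iterate:
  assumes "\<And>i. i \<in> I \<Longrightarrow> continuous_on (X i) T" "J \<in> cylinders T I X m"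
  shows "continuous_on J (T ^^ m)"
proof -
  obtain w where w: "J = (\<Inter>k<m. (T ^^ k) -` X (w k))" "\<forall>k<m. w k \<in> I"
    using assms(2) by (auto simp: cylinders_def)
  have "continuous_on J (T ^^ k)" if "k \<le> m" for k
    using that
  proof (induction k)
    case (Suc k)
    then have "continuous_on J (\<lambda>x. T ((T ^^ k) x))"
      using w by (intro continuous_on_compose2[OF assms(1)[of "w k"] Suc.IH]) auto
    then show ?case by (simp add: comp_def)
  qed (simp add: id_def)
  then show ?thesis by blast
qed

text \<open>Since the cylinder is nonempty, the image reached so far meets the set of the next
  letter and hence contains it by the Markov property; only the last letter leaves a trace. Images
  of cylinders of every order thus inherit measurability and the lower bound on measure from the
  sets \<open>X i\<close>.\<close>

lemma image_iterate_cylinder: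
  assumes markov: "\<And>i j. i \<in> I \<Longrightarrow> j \<in> I \<Longrightarrow> T ` X i \<inter> X j \<noteq> {} \<Longrightarrow> X j \<subseteq> T ` X i"
    and w: "\<forall>k\<le>m. w k \<in> I" and ne: "(\<Inter>k<Suc m. (T ^^ k) -` X (w k)) \<noteq> {}"
  shows "(T ^^ Suc m) ` (\<Inter>k<Suc m. (T ^^ k) -` X (w k)) = T ` X (w m)"
  using w ne
proof (induction m)
  case 0
  then show ?case by (simp add: lessThan_Suc)
next
  case (Suc m)
  define J where "J = (\<Inter>k<Suc m. (T ^^ k) -` X (w k))"
  define Z where "Z = X (w (Suc m))"
  have eq: "(\<Inter>k<Suc (Suc m). (T ^^ k) -` X (w k)) = J \<inter> (T ^^ Suc m) -` Z"
    unfolding J_def Z_def by (subst lessThan_Suc) auto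
  obtain x where x: "x \<in> J" "(T ^^ Suc m) x \<in> Z"
    using Suc.prems(2) unfolding eq by blast
  then have IH: "(T ^^ Suc m) ` J = T ` X (w m)"
    using Suc.IH Suc.prems(1) unfolding J_def by fastforce
  have "(T ^^ Suc m) x \<in> T ` X (w m) \<inter> Z" using x unfolding IH[symmetric] by blast
  then have "Z \<subseteq> (T ^^ Suc m) ` J" unfolding IH Z_def
    by (intro markov) (use Suc.prems(1) in auto)
  then have "(T ^^ Suc m) ` (J \<inter> (T ^^ Suc m) -` Z) = Z" by blast
  moreover have "(T ^^ Suc (Suc m)) ` B = T ` (T ^^ Suc m) ` B" for B
    by (simp only: funpow.simps(2)[of "Suc m"] image_comp)
  ultimately show ?case unfolding eq by (simp only: Z_def)
qed

lemma measure_preserving_iterate: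
  assumes "measure_preserving_map M T"
  shows "(T ^^ n) \<in> measurable M M" "distr M M (T ^^ n) = M"
proof -
  have T: "T \<in> measurable M M" "distr M M T = M" using assms by (auto simp: measure_preserving_map_def)
  show m: "(T ^^ n) \<in> measurable M M" for n
  proof (induction n)
    case (Suc n)
    then show ?case using measurable_comp[OF Suc T(1)] by (simp only: funpow.simps)
  qed (simp add: id_def)
  show "distr M M (T ^^ n) = M"
  proof (induction n)
    case 0
    then show ?case using distr_id[of M] by (simp add: id_def)
  next
    case (Suc n)
    have "distr M M (T \<circ> T ^^ n) = distr (distr M M (T ^^ n)) M T"
      using T(1) m by (intro distr_distr[symmetric]) auto
    then show ?case using Suc T(2) by (simp only: funpow.simps)
  qed
qed

text \<open>By invariance each iterate maps almost every point into the union of the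
  \<open>X i\<close>, and countably many null sets are excluded at once.\<close>

lemma AE_in_cylinders:
  assumes mp: "measure_preserving_map M T" and AE: "AE x in M. x \<in> (\<Union>i\<in>I. X i)"
  shows "AE x in M. x \<in> \<Union>(cylinders T I X m)"
proof -
  have "AE x in M. (T ^^ k) x \<in> (\<Union>i\<in>I. X i)" for k
  proof (rule AE_distrD[OF measure_preserving_iterate(1)[OF mp]])
    show "AE x in distr M M (T ^^ k). x \<in> (\<Union>i\<in>I. X i)"
      unfolding measure_preserving_iterate(2)[OF mp] by (rule AE)
  qed
  then have "AE x in M. \<forall>k. (T ^^ k) x \<in> (\<Union>i\<in>I. X i)" by (simp add: AE_all_countable)
  then show ?thesis
  proof eventually_elim
    case (elim x)
    then have "\<forall>k. \<exists>i\<in>I. (T ^^ k) x \<in> X i" by blast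
    then obtain w where "\<forall>k. w k \<in> I \<and> (T ^^ k) x \<in> X (w k)" by metis
    then show ?case unfolding cylinders_def by blast
  qed
qed

text \<open>Bounded distortion makes all difference quotients of \<open>T ^^ m\<close> on a cylinder comparable, by
  passing from one pair of points to another through a common point.\<close>

lemma cylinder_bilipschitz:
  fixes K\<^sub>1 \<kappa> :: real
  assumes distortion: "\<And>x y z. x \<in> J \<Longrightarrow> y \<in> J \<Longrightarrow> z \<in> J \<Longrightarrow> x \<noteq> y \<Longrightarrow> x \<noteq> z \<Longrightarrow>
      (dist (S x) (S y) / dist x y) / (dist (S x) (S z) / dist x z) \<le> K\<^sub>1"
    and "0 < K\<^sub>1" "0 < \<kappa>"
    and low: "\<And>x y. x \<in> J \<Longrightarrow> y \<in> J \<Longrightarrow> x \<noteq> y \<Longrightarrow> \<kappa> \<le> dist (S x) (S y) / dist x y"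
  shows "\<exists>K\<ge>\<kappa>. \<forall>x\<in>J. \<forall>y\<in>J. K * dist x y \<le> dist (S x) (S y) \<and>
    dist (S x) (S y) \<le> (1 + K\<^sub>1)\<^sup>2 * K * dist x y"
proof (cases "\<exists>x\<in>J. \<exists>y\<in>J. x \<noteq> y")
  case False
  then have "\<forall>x\<in>J. \<forall>y\<in>J. x = y" by blast
  \<comment> \<open>There is no difference quotient here, so \<open>\<kappa>\<close> itself serves
    as \<open>K\<close>.\<close>
  then show ?thesis by (intro exI[of _ \<kappa>]) auto
next
  case True
  define q where "q x y = dist (S x) (S y) / dist x y" for x y
  define D where "D = {q x y | x y. x \<in> J \<and> y \<in> J \<and> x \<noteq> y}"
  \<comment> \<open>The real-valued counterpart of \<open>min_expansion\<close>.\<close>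
  define K where "K = Inf D"
  have ne: "D \<noteq> {}" using True by (auto simp: D_def)
  have lowD: "\<kappa> \<le> d" if "d \<in> D" for d using low that by (auto simp: D_def q_def)
  have "\<kappa> \<le> K" unfolding K_def using ne lowD by (rule cInf_greatest)
  have sym: "q x y = q y x" for x y by (simp add: q_def dist_commute)
  have qpos: "0 < q x y" if "x \<in> J" "y \<in> J" "x \<noteq> y" for x y
    using low[OF that] \<open>0 < \<kappa>\<close> by (simp add: q_def)
  have step: "q x y \<le> K\<^sub>1 * q x z" if "x \<in> J" "y \<in> J" "z \<in> J" "x \<noteq> y" "x \<noteq> z" for x y z
    using distortion[OF that] qpos[of x z] that by (simp add: q_def[symmetric] pos_divide_le_eq)
  \<comment> \<open>One constant covers both one and two uses of distortion, whether or not
    \<open>K\<^sub>1\<close> exceeds 1.\<close>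
  have K1sq: "K\<^sub>1 \<le> (1 + K\<^sub>1)\<^sup>2" "K\<^sub>1 * K\<^sub>1 \<le> (1 + K\<^sub>1)\<^sup>2"
    using \<open>0 < K\<^sub>1\<close> by (simp_all add: power2_eq_square algebra_simps)
  have compare: "q u v \<le> (1 + K\<^sub>1)\<^sup>2 * q x y"
    if "u \<in> J" "v \<in> J" "u \<noteq> v" "x \<in> J" "y \<in> J" "x \<noteq> y" for u v x y
  \<comment> \<open>The connecting pair is \<open>u\<close> and \<open>y\<close>. If they coincide
    it degenerates, but then the two given pairs already share a point.\<close>
  proof (cases "u = y")
    case True
    have "q u v \<le> K\<^sub>1 * q y x" using step[of y v x] that True by simp
    also have "\<dots> \<le> (1 + K\<^sub>1)\<^sup>2 * q y x" using K1sq qpos[of y x] that by (intro mult_right_mono) auto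
    finally show ?thesis by (simp add: sym)
  next
    case False
    have "q u v \<le> K\<^sub>1 * q u y" using step[of u v y] that False by simp
    also have "q u y \<le> K\<^sub>1 * q y x" using step[of y u x] that False by (simp add: sym)
    finally have "q u v \<le> K\<^sub>1 * K\<^sub>1 * q y x" using \<open>0 < K\<^sub>1\<close> by simp
    also have "\<dots> \<le> (1 + K\<^sub>1)\<^sup>2 * q y x" using K1sq qpos[of y x] that by (intro mult_right_mono) auto
    finally show ?thesis by (simp add: sym)
  qed
  have upper: "q u v \<le> (1 + K\<^sub>1)\<^sup>2 * K" if "u \<in> J" "v \<in> J" "u \<noteq> v" for u v
  proof -
    have "q u v / (1 + K\<^sub>1)\<^sup>2 \<le> K"
      unfolding K_def using ne
    proof (rule cInf_greatest)
      fix d assume "d \<in> D"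
      then show "q u v / (1 + K\<^sub>1)\<^sup>2 \<le> d"
        using compare[OF that] \<open>0 < K\<^sub>1\<close> by (auto simp: D_def field_simps)
    qed
    then show ?thesis using \<open>0 < K\<^sub>1\<close> by (simp add: field_simps)
  qed
  have lower: "K \<le> q u v" if "u \<in> J" "v \<in> J" "u \<noteq> v" for u v
    unfolding K_def by (rule cInf_lower) (use that lowD in \<open>auto simp: D_def intro!: bdd_belowI\<close>)
  show ?thesis
  proof (intro exI[of _ K] conjI ballI)
    fix x y assume xy: "x \<in> J" "y \<in> J"
    show "K * dist x y \<le> dist (S x) (S y)"
      using lower[OF xy] by (cases "x = y") (auto simp: q_def pos_le_divide_eq)
    show "dist (S x) (S y) \<le> (1 + K\<^sub>1)\<^sup>2 * K * dist x y"
      using upper[OF xy] by (cases "x = y") (auto simp: q_def pos_divide_le_eq)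
  qed fact
qed

lemma expanding_eventually:
  assumes "expanding T I X \<delta>" "0 < (\<kappa> :: real)"
  shows "\<forall>\<^sub>F m in sequentially. \<forall>J\<in>cylinders T I X m. \<forall>x\<in>J. \<forall>y\<in>J. x \<noteq> y \<longrightarrow>
    \<kappa> \<le> dist ((T ^^ m) x) ((T ^^ m) y) / dist x y"
proof -
  have "(\<lambda>m. INF J\<in>cylinders T I X m. min_expansion T m J) \<longlonglongrightarrow> \<infinity>"
    using assms(1) by (simp add: expanding_def)
  then have "\<forall>\<^sub>F m in sequentially. ennreal \<kappa> < (INF J\<in>cylinders T I X m. min_expansion T m J)"
    by (rule order_tendstoD(1)) simp
  then show ?thesis
  proof (eventually_elim, intro ballI impI)
    fix m J x y
    assume "ennreal \<kappa> < (INF J\<in>cylinders T I X m. min_expansion T m J)" "J \<in> cylinders T I X m"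
      and xy: "x \<in> J" "y \<in> J" "x \<noteq> y"
    then have "ennreal \<kappa> \<le> min_expansion T m J" by (meson INF_lower less_imp_le less_le_trans)
    also have "\<dots> \<le> ennreal (dist ((T ^^ m) x) ((T ^^ m) y) / dist x y)"
      unfolding min_expansion_def using xy by (intro Inf_lower) blast
    finally show "\<kappa> \<le> dist ((T ^^ m) x) ((T ^^ m) y) / dist x y" by (simp add: ennreal_le_iff)
  qed
qed

section \<open>Cylinders as branches, and the passage to piecewise Lipschitz maps\<close>

theorem theorem1p5:
  fixes M :: "'a::{metric_space, second_countable_topology} measure"
    and T f :: "'a \<Rightarrow> 'a"
    and I :: "'i set" and X :: "'i \<Rightarrow> 'a set"
    and \<delta> :: real and \<psi> :: "nat \<Rightarrow> real"
  assumes "compact (UNIV :: 'a set)"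
    and "prob_space M" and "sets M = sets borel"
    and "measure_preserving_map M T"
    and "branch_domains M T I X"
    and "0 < \<delta>"
    and "ahlfors_regular M \<delta>"
    and "uniformly_mixing M T"
    and "bounded_distortion T I X"
    and "expanding T I X \<delta>"
    and "conformal T I X"
    and "\<forall>n\<ge>1. 0 < \<psi> n"
    and "\<psi> \<longlonglongrightarrow> 0"
    and "piecewise_lipschitz M f"
    and "pseudo_markov M T I X"
    and "\<not> summable (\<lambda>n. \<psi> (Suc n) powr \<delta>)"
  shows "measure (completion M) (recurrence_set T f \<psi>) = 1"
proof -
  interpret prob_space M by fact
  interpret completion: prob_space "completion M"
    by (rule prob_spaceI) (simp add: emeasure_space_1)
  note sets_eq = \<open>sets M = sets borel\<close>
  have space_eq: "space M = UNIV" using sets_eq_imp_space_eq[OF sets_eq] by simp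
  have T: "T \<in> measurable M M" using assms(4) by (simp add: measure_preserving_map_def)
  obtain \<eta>\<^sub>1 \<eta>\<^sub>2 r\<^sub>0 where \<eta>: "0 < \<eta>\<^sub>1" "0 < \<eta>\<^sub>2" "0 < r\<^sub>0"
    and ahlfors: "\<And>x r. 0 < r \<Longrightarrow> r < r\<^sub>0 \<Longrightarrow> \<eta>\<^sub>1 * r powr \<delta> \<le> prob (ball x r) \<and> prob (ball x r) \<le> \<eta>\<^sub>2 * r powr \<delta>"
    using assms(7) unfolding ahlfors_regular_def by blast
  obtain a where a: "\<And>n. 1 \<le> n \<Longrightarrow> 0 < a n" "summable (\<lambda>n. a (Suc n))"
    and mixing: "\<And>n r s x y. 1 \<le> n \<Longrightarrow> 0 < r \<Longrightarrow> 0 < s \<Longrightarrow>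
       \<bar>prob (ball x r \<inter> (T ^^ n) -` ball y s) - prob (ball x r) * prob (ball y s)\<bar> \<le> a n * prob (ball y s)"
    using assms(8) unfolding uniformly_mixing_def by blast
  obtain K\<^sub>1 :: real where K1: "0 < K\<^sub>1" and "\<forall>m\<ge>1. \<forall>J\<in>cylinders T I X m. \<forall>x\<in>J. \<forall>y\<in>J. \<forall>z\<in>J.
      x \<noteq> y \<and> x \<noteq> z \<longrightarrow>
      inverse K\<^sub>1 \<le> (dist ((T ^^ m) x) ((T ^^ m) y) / dist x y) / (dist ((T ^^ m) x) ((T ^^ m) z) / dist x z) \<and>
      (dist ((T ^^ m) x) ((T ^^ m) y) / dist x y) / (dist ((T ^^ m) x) ((T ^^ m) z) / dist x z) \<le> K\<^sub>1"
    using assms(9) unfolding bounded_distortion_def Let_def by (elim exE conjE) (rule that)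
  then have distortion: "\<And>m J x y z. 1 \<le> m \<Longrightarrow> J \<in> cylinders T I X m \<Longrightarrow>
      x \<in> J \<Longrightarrow> y \<in> J \<Longrightarrow> z \<in> J \<Longrightarrow> x \<noteq> y \<Longrightarrow> x \<noteq> z \<Longrightarrow>
      (dist ((T ^^ m) x) ((T ^^ m) y) / dist x y) / (dist ((T ^^ m) x) ((T ^^ m) z) / dist x z) \<le> K\<^sub>1"
    by simp
  obtain \<tau> where \<tau>: "0 < \<tau>" "\<And>i. i \<in> I \<Longrightarrow> \<tau> \<le> prob (T ` X i)"
    and markov: "\<And>i. i \<in> I \<Longrightarrow> T ` X i \<in> events"
      "\<And>i j. i \<in> I \<Longrightarrow> j \<in> I \<Longrightarrow> T ` X i \<inter> X j \<noteq> {} \<Longrightarrow> X j \<subseteq> T ` X i"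
    using assms(15) unfolding pseudo_markov_def by (auto simp: prob_space)
  have X: "countable I" "disjoint_family_on X I" "\<And>i. i \<in> I \<Longrightarrow> open (X i)"
      "\<And>i. i \<in> I \<Longrightarrow> continuous_on (X i) T"
    and X_full: "emeasure M (space M - (\<Union>i\<in>I. X i)) = 0"
    using assms(5) unfolding branch_domains_def by auto
  have "open (\<Union>i\<in>I. X i)" using X(3) by auto
  then have "(\<Union>i\<in>I. X i) \<in> events" by (simp add: sets_eq)
  then have "space M - (\<Union>i\<in>I. X i) \<in> null_sets M" using X_full by auto
  then have X_AE: "AE x in M. x \<in> (\<Union>i\<in>I. X i)" by (rule AE_I') auto
  have cyl_meas: "J \<in> events" if "J \<in> cylinders T I X m" "1 \<le> m" for J m
  proof -
    obtain w where w: "J = (\<Inter>k<m. (T ^^ k) -` X (w k))" "\<forall>k<m. w k \<in> I"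
      using \<open>J \<in> _\<close> by (auto simp: cylinders_def)
    have "(T ^^ k) -` X (w k) \<in> events" if "k < m" for k
      using measurable_sets[OF measure_preserving_iterate(1)[OF assms(4)], of "X (w k)" k] X(3) w that
      by (simp add: space_eq sets_eq)
    then show ?thesis unfolding w using \<open>1 \<le> m\<close> by (intro sets.finite_INT) (auto simp: lessThan_empty_iff)
  qed
  have branches: "\<forall>\<^sub>F m in sequentially. \<exists>\<F>. countable \<F> \<and> disjoint \<F> \<and> \<F> \<subseteq> events \<and> prob (\<Union>\<F>) = 1 \<and>
      (\<forall>J\<in>\<F>. continuous_on J (T ^^ m) \<and> (T ^^ m) ` J \<in> events \<and> \<tau> \<le> prob ((T ^^ m) ` J) \<and>
        (\<exists>K\<ge>\<kappa>. \<forall>x\<in>J. \<forall>y\<in>J. K * dist x y \<le> dist ((T ^^ m) x) ((T ^^ m) y) \<and>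
          dist ((T ^^ m) x) ((T ^^ m) y) \<le> (1 + K\<^sub>1)\<^sup>2 * K * dist x y))" for \<kappa>
  proof -
    have "\<forall>\<^sub>F m in sequentially. (1::nat) \<le> m" by (rule eventually_ge_at_top)
    \<comment> \<open>The maximum with 1 provides the positive bound that
      \<open>cylinder_bilipschitz\<close> requires, for every real \<open>\<kappa>\<close>.\<close>
    moreover have "\<forall>\<^sub>F m in sequentially. \<forall>J\<in>cylinders T I X m. \<forall>x\<in>J. \<forall>y\<in>J. x \<noteq> y \<longrightarrow>
      max \<kappa> 1 \<le> dist ((T ^^ m) x) ((T ^^ m) y) / dist x y"
      by (rule expanding_eventually[OF assms(10)]) simp
    ultimately show ?thesis
    proof eventually_elim
      case (elim m)
      \<comment> \<open>The empty cylinder would violate the bound \<open>\<tau>\<close> on images;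
        removing it does not change the union.\<close>
      let ?F = "cylinders T I X m - {{}}"
      have F: "countable ?F" "disjoint ?F" "?F \<subseteq> events"
        using cylinders_countable[OF X(1), of T X m] cylinders_disjoint[OF X(2), of T m] cyl_meas elim(1)
        by (auto simp: disjoint_def)
      have Un: "\<Union>?F = \<Union>(cylinders T I X m)" by auto
      have "\<Union>?F \<in> events" using F by (intro sets.countable_Union)
      then have "prob (\<Union>?F) = 1"
        using AE_in_cylinders[OF assms(4) X_AE, of m] unfolding Un by (subst prob_eq_1)
      moreover have "continuous_on J (T ^^ m) \<and> (T ^^ m) ` J \<in> events \<and> \<tau> \<le> prob ((T ^^ m) ` J) \<and>
        (\<exists>K\<ge>\<kappa>. \<forall>x\<in>J. \<forall>y\<in>J. K * dist x y \<le> dist ((T ^^ m) x) ((T ^^ m) y) \<and>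
          dist ((T ^^ m) x) ((T ^^ m) y) \<le> (1 + K\<^sub>1)\<^sup>2 * K * dist x y)" if J: "J \<in> ?F" for J
      proof (intro conjI)
        show "continuous_on J (T ^^ m)" by (rule cylinder_continuous_iterate[where I = I and X = X]) (use X(4) J in auto)
        obtain w where w: "J = (\<Inter>k<m. (T ^^ k) -` X (w k))" "\<forall>k<m. w k \<in> I" "J \<noteq> {}"
          using J by (auto simp: cylinders_def)
        \<comment> \<open>The last of the \<open>m\<close> letters has index
          \<open>m - 1\<close>.\<close>
        obtain m' where m: "m = Suc m'" using elim(1) by (cases m) auto
        have "(T ^^ m) ` J = T ` X (w m')"
          unfolding w(1) m by (rule image_iterate_cylinder[OF markov(2)]) (use w m in auto)
        then show "(T ^^ m) ` J \<in> events" "\<tau> \<le> prob ((T ^^ m) ` J)" using markov(1) \<tau>(2) w m by auto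
        have "J \<in> cylinders T I X m" using J by simp
        then have "\<exists>K\<ge>max \<kappa> 1. \<forall>x\<in>J. \<forall>y\<in>J. K * dist x y \<le> dist ((T ^^ m) x) ((T ^^ m) y) \<and>
          dist ((T ^^ m) x) ((T ^^ m) y) \<le> (1 + K\<^sub>1)\<^sup>2 * K * dist x y"
          using elim(2) K1 by (intro cylinder_bilipschitz distortion[OF elim(1)]) simp_all
        then show "\<exists>K\<ge>\<kappa>. \<forall>x\<in>J. \<forall>y\<in>J. K * dist x y \<le> dist ((T ^^ m) x) ((T ^^ m) y) \<and>
          dist ((T ^^ m) x) ((T ^^ m) y) \<le> (1 + K\<^sub>1)\<^sup>2 * K * dist x y" by auto
      qed
      ultimately show ?case using F by blast
    qed
  qed
  \<comment> \<open>Mixing gives no information on \<open>a 0\<close>, so this value is replaced by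
    0.\<close>
  define a' where "a' n = (if n = 0 then 0 else a n)" for n
  have a': "0 \<le> a' n" for n using a(1)[of n] by (auto simp: a'_def intro: less_imp_le)
  have "(\<lambda>n. a' (Suc n)) = (\<lambda>n. a (Suc n))" by (simp add: a'_def)
  then have a'_summable: "summable a'" using a(2) summable_Suc_iff[of a'] by simp
  have \<psi>_div: "\<not> summable (\<lambda>n. \<psi> n powr \<delta>)"
    using assms(16) summable_Suc_iff[of "\<lambda>n. \<psi> n powr \<delta>"] by simp
  have lipschitz_case: "recurrence_set T g \<psi> \<in> events \<and> prob (recurrence_set T g \<psi>) = 1"
    if "C-lipschitz_on UNIV g" for C and g :: "'a \<Rightarrow> 'a"
  proof -
    interpret branched_recurrence M \<delta> \<eta>\<^sub>1 \<eta>\<^sub>2 r\<^sub>0 T g a' \<psi> C "(1 + K\<^sub>1)\<^sup>2" \<tau>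
    proof unfold_locales
      show "1 \<le> (1 + K\<^sub>1)\<^sup>2" using K1 by (simp add: one_le_power)
    next
      fix n :: nat and r s :: real and x y :: 'a assume "1 \<le> n" "0 < r" "0 < s"
      then show "\<bar>prob (ball x r \<inter> (T ^^ n) -` ball y s) - prob (ball x r) * prob (ball y s)\<bar>
          \<le> a' n * prob (ball y s)"
        using mixing[of n r s x y] by (simp add: a'_def)
    qed (use assms(1,6,12,13) sets_eq \<eta> ahlfors T a' a'_summable that \<psi>_div \<tau> branches in auto)
    have "recurrence_set T g \<psi> = {x. \<exists>\<^sub>\<infinity>n. x \<in> hits n}" by (simp add: recurrence_set_def hits_def)
    moreover have "{x. \<exists>\<^sub>\<infinity>n. x \<in> hits n} = (\<Inter>k. \<Union>n\<in>{k..}. hits n)" by (auto simp: INFM_nat_le)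
    \<comment> \<open>Measurability can be read off from the measure being 1, since
      \<open>measure\<close> is 0 on non-measurable sets.\<close>
    ultimately show ?thesis using prob_hits_infinitely_often by (metis measure_notin_sets zero_neq_one)
  qed
  obtain N :: "nat set" and Y g where Y: "\<And>i. i \<in> N \<Longrightarrow> Y i \<in> events"
      "\<And>i. i \<in> N \<Longrightarrow> \<exists>C. C-lipschitz_on UNIV (g i)" "\<And>i x. i \<in> N \<Longrightarrow> x \<in> Y i \<Longrightarrow> f x = g i x"
    and Y_full: "emeasure M (space M - (\<Union>i\<in>N. Y i)) = 0"
    using assms(14) unfolding piecewise_lipschitz_def by blast
  have Rg: "recurrence_set T (g i) \<psi> \<in> events" "AE x in M. x \<in> recurrence_set T (g i) \<psi>" if "i \<in> N" for i
    using lipschitz_case Y(2)[OF that] prob_eq_1 by blast+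
  \<comment> \<open>A Borel set of full measure inside the recurrence set of \<open>f\<close>: on
    \<open>Y i\<close> the maps \<open>f\<close> and \<open>g i\<close> agree, hence so do their
    recurrence conditions.\<close>
  define W where "W = (\<Union>i\<in>N. Y i \<inter> recurrence_set T (g i) \<psi>)"
  have W: "W \<in> events" unfolding W_def using Rg(1) Y(1) by (intro sets.countable_UN') auto
  have W_sub: "W \<subseteq> recurrence_set T f \<psi>" by (auto simp: W_def recurrence_set_def Y(3))
  have "(\<Union>i\<in>N. Y i) \<in> events" using Y(1) by (intro sets.countable_UN') auto
  then have "space M - (\<Union>i\<in>N. Y i) \<in> null_sets M" using Y_full by auto
  then have "AE x in M. x \<in> (\<Union>i\<in>N. Y i)" by (rule AE_I') auto
  moreover have "AE x in M. \<forall>i\<in>N. x \<in> recurrence_set T (g i) \<psi>"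
    using Rg(2) by (simp add: AE_ball_countable)
  ultimately have "AE x in M. x \<in> W" by eventually_elim (auto simp: W_def)
  then have "prob W = 1" using prob_eq_1[OF W] by simp
  then have "- W \<in> null_sets M"
    using sets.compl_sets[OF W] prob_compl[OF W]
    by (intro null_setsI) (simp_all add: space_eq Compl_eq_Diff_UNIV emeasure_eq_measure)
  \<comment> \<open>The recurrence set is \<open>W\<close> together with a subset of the null set
    \<open>- W\<close>.\<close>
  then have "recurrence_set T f \<psi> \<in> sets (completion M)"
    using W W_sub by (intro sets_completionI[of _ W "recurrence_set T f \<psi> - W" "- W"]) auto
  then have "measure (completion M) W \<le> measure (completion M) (recurrence_set T f \<psi>)"
    using W_sub by (intro completion.finite_measure_mono)
  then show ?thesis using \<open>prob W = 1\<close> W completion.prob_le_1[of "recurrence_set T f \<psi>"] by simp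
qed

end
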